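(* Let $u\in W^{2,2}(\mathbb{R}^n)$, $n\ge 3$, be a solution of the differential inequality $|\Delta u(x)|\le |V(x)u(x)|$, whose support is contained in a ball $B(a,r)$. If $\mathbf{1}_{B(a,r)}V\in\widetilde{\mathcal{K}}_n$, then there exists $r_0>0$ such that for all $r<r_0$ $$\eta(2r,V)\ge C>0$$ with a constant $C$ independent of $r$.
   Context: $V$ is a potential function on $\mathbb{R}^n$, $n\ge 3$. $W^{m,p}(\mathbb{R}^n)$ denotes the Sobolev space of functions whose derivatives up to order $m$ belong to $L^p(\mathbb{R}^n)$. $B(x,r)$ is the ball of radius $r>0$ centered at $x\in\mathbb{R}^n$, and $\mathbf{1}_A$ is the characteristic function of a set $A\subset\mathbb{R}^n$. For $r>0$, $$\eta(r,V)=\sup_{x\in\mathbb{R}^n}\int_{|x-y|<r}\frac{|V(y)|}{|x-y|^{n-2}}\,dy.$$ The class $\widetilde{\mathcal{K}}_n$ (a variant of the Kato class) is defined by: $V\in\widetilde{\mathcal{K}}_n$ if and only if $\eta(r,V)<\infty$ for all $r>0$.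
   Formalization: The solution u is assumed not to vanish almost everywhere, since for u = 0 and V = 0 all hypotheses hold but η(2r,V) = 0. *)

theory Defs
  imports "HOL-Analysis.Analysis"
begin

definition partial_deriv :: "'n::finite \<Rightarrow> (real ^ 'n \<Rightarrow> real) \<Rightarrow> real ^ 'n \<Rightarrow> real" where
  "partial_deriv i f x = frechet_derivative f (at x) (axis i 1)"

fun iter_partial_deriv :: "'n::finite list \<Rightarrow> (real ^ 'n \<Rightarrow> real) \<Rightarrow> real ^ 'n \<Rightarrow> real" where
  "iter_partial_deriv [] f = f"
| "iter_partial_deriv (i # is) f = partial_deriv i (iter_partial_deriv is f)"

fun C_k :: "nat \<Rightarrow> (real ^ 'n::finite \<Rightarrow> real) \<Rightarrow> bool" where
  "C_k 0 f \<longleftrightarrow> continuous_on UNIV f"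
| "C_k (Suc k) f \<longleftrightarrow> f differentiable_on UNIV \<and> (\<forall>i. C_k k (partial_deriv i f))"

definition test_functions :: "(real ^ 'n::finite \<Rightarrow> real) set" where
  "test_functions = {\<phi>. (\<forall>k. C_k k \<phi>) \<and> compact (closure {x. \<phi> x \<noteq> 0})}"

definition locally_integrable :: "(real ^ 'n::finite \<Rightarrow> complex) \<Rightarrow> bool" where
  "locally_integrable f \<longleftrightarrow> (\<forall>K. compact K \<longrightarrow> set_integrable lebesgue K f)"

text \<open>Instead of multi-indices we use lists of coordinate directions: the list \<open>[i, j, \<dots>]\<close>
  stands for the derivative \<open>\<partial>\<^sub>i \<partial>\<^sub>j \<dots>\<close>.  As partial derivatives of test functions commute,
  lists of length \<open>k\<close> yield exactly the derivatives of order \<open>k\<close>.\<close>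

definition has_weak_deriv ::
  "'n::finite list \<Rightarrow> (real ^ 'n \<Rightarrow> complex) \<Rightarrow> (real ^ 'n \<Rightarrow> complex) \<Rightarrow> bool" where
  "has_weak_deriv is u g \<longleftrightarrow> locally_integrable u \<and> locally_integrable g \<and>
     (\<forall>\<phi>\<in>test_functions.
        (LINT x|lebesgue. iter_partial_deriv is \<phi> x *\<^sub>R u x) =
        (- 1) ^ length is * (LINT x|lebesgue. \<phi> x *\<^sub>R g x))"

definition Lp :: "real \<Rightarrow> (real ^ 'n::finite \<Rightarrow> complex) set" where
  "Lp p = {f \<in> borel_measurable lebesgue. integrable lebesgue (\<lambda>x. norm (f x) powr p)}"

text \<open>Elements of \<open>sobolev m p\<close> (for \<open>1 \<le> p < \<infinity>\<close>) are functions, not classes modulo null sets.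
  The case of the empty list says that \<open>u\<close> itself lies in \<open>L\<^sup>p\<close>.\<close>

definition sobolev :: "nat \<Rightarrow> real \<Rightarrow> (real ^ 'n::finite \<Rightarrow> complex) set" where
  "sobolev m p =
     {u \<in> Lp p. \<forall>is. length is \<le> m \<longrightarrow> (\<exists>g\<in>Lp p. has_weak_deriv is u g)}"

text \<open>A weak derivative is only determined almost everywhere; \<open>weak_deriv\<close> picks a representative.
  It is meaningful only if a weak derivative exists, as it does for orders up to \<open>m\<close> on
  \<open>sobolev m p\<close>.\<close>

definition weak_deriv ::
  "'n::finite list \<Rightarrow> (real ^ 'n \<Rightarrow> complex) \<Rightarrow> real ^ 'n \<Rightarrow> complex" where
  "weak_deriv is u = (SOME g. has_weak_deriv is u g)"

definition laplacian :: "(real ^ 'n::finite \<Rightarrow> complex) \<Rightarrow> real ^ 'n \<Rightarrow> complex" where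
  "laplacian u x = (\<Sum>i\<in>UNIV. weak_deriv [i, i] u x)"

text \<open>The support of a function defined up to null sets: the complement of the largest open set
  on which it vanishes almost everywhere.\<close>

definition ess_support :: "(real ^ 'n::finite \<Rightarrow> complex) \<Rightarrow> (real ^ 'n) set" where
  "ess_support u = - \<Union>{U. open U \<and> (AE x in lebesgue. x \<in> U \<longrightarrow> u x = 0)}"

text \<open>The integrand at \<open>y = x\<close> is \<open>0\<close> by the convention for division by zero, which only affects
  a null set.  The exponent is natural-number subtraction, used for dimension at least 3.\<close>

definition kato_eta :: "real \<Rightarrow> (real ^ 'n::finite \<Rightarrow> complex) \<Rightarrow> ennreal" where
  "kato_eta r V =
     (SUP x. \<integral>\<^sup>+y\<in>ball x r. ennreal (norm (V y) / norm (x - y) ^ (CARD('n) - 2)) \<partial>lebesgue)"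

definition kato_class :: "(real ^ 'n::finite \<Rightarrow> complex) set" where
  "kato_class = {V \<in> borel_measurable lebesgue. \<forall>r>0. kato_eta r V < \<infinity>}"

end

(* A solution with support in B = B(a,r) satisfies |u| <= (1/kappa) I(|Delta u|) almost everywhere, where
   I(h)(x) is the integral of h(y) / |x-y|^(n-2) over y and kappa depends only on n.  To see this, test the
   weak Laplacian with (|y-x|^2 + e^2)^((2-n)/2), cut off away from B: it is at most |y-x|^(2-n), and minus
   its Laplacian is e^(-n) k((y-x)/e) with k(z) = n (n-2) (1+|z|^2)^(-n/2-1), an approximate identity of
   mass kappa.
   Multiply the bound by |V|, use |Delta u| <= |V u|, integrate over B and exchange the integrals: since
   B is contained in B(y,2r) for y in B, the integral H of |Delta u| satisfies kappa H <= eta(2r,V) H.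
   Here H is finite because |Delta u| is locally integrable (this would not be clear for |V u|), and H > 0
   because otherwise u = 0.  So C = kappa works for every r. *)

theory Submission
  imports Defs
begin

subsection \<open>Functions of class C_k\<close>

text \<open>The function |y-x|^(2-n) has a pole at x, so it cannot be tested directly. Adding e^2
  removes the pole and keeps the upper bound by |y-x|^(2-n), so e never appears on the right of the
  estimate. The cutoff costs nothing: it is constant on the open ball off which u and Delta u
  vanish. The obstacle is the limit e -> 0. As u is only integrable, continuity gives no convergence
  of the mollifications at a given point, and the potential on the right may be infinite. Hence u is
  compared with a bounded continuous function in the mean, and the error is integrated over x before
  e tends to 0; this yields the bound almost everywhere. Test functions must be \<open>C_k\<close>
  for every k. All of them are built from the squared distance by sums, products and composition
  with one-variable functions whose full sequence of derivatives is explicit. The weak equation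
  lives on \<open>lebesgue\<close>, whereas convolution, scaling and Tonelli are carried out on
  \<open>lborel\<close>; Borel representatives connect the two.\<close>

lemma partial_deriv_eqI:
  assumes "(f has_derivative f') (at x)"
  shows "partial_deriv i f x = f' (axis i 1)"
  unfolding partial_deriv_def using frechet_derivative_at[OF assms] by simp

lemma partial_deriv_const: "partial_deriv i (\<lambda>x. c) = (\<lambda>x. 0)"
  by (rule ext, subst partial_deriv_eqI[OF has_derivative_const]) simp

lemma partial_deriv_add:
  assumes "f differentiable at x" "g differentiable at x"
  shows "partial_deriv i (\<lambda>x. f x + g x) x = partial_deriv i f x + partial_deriv i g x"
  using partial_deriv_eqI[OF has_derivative_add[OF assms[unfolded frechet_derivative_works]]]
  by (simp add: partial_deriv_def)

lemma partial_deriv_mult: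
  assumes "f differentiable at x" "g differentiable at x"
  shows "partial_deriv i (\<lambda>x. f x * g x) x = partial_deriv i f x * g x + f x * partial_deriv i g x"
  using partial_deriv_eqI[OF has_derivative_mult[OF assms[unfolded frechet_derivative_works]]]
  by (simp add: partial_deriv_def)

lemma has_derivative_real_compose:
  fixes G :: "real \<Rightarrow> real"
  assumes "f differentiable at x" "(G has_real_derivative d) (at (f x))"
  shows "((\<lambda>x. G (f x)) has_derivative (\<lambda>h. d * frechet_derivative f (at x) h)) (at x)"
  using has_derivative_compose[OF assms(1)[unfolded frechet_derivative_works]
      assms(2)[unfolded has_field_derivative_def]] by simp

lemma partial_deriv_compose:
  assumes "f differentiable at x" "(G has_real_derivative d) (at (f x))"
  shows "partial_deriv i (\<lambda>x. G (f x)) x = d * partial_deriv i f x"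
  using partial_deriv_eqI[OF has_derivative_real_compose[OF assms]] by (simp add: partial_deriv_def)

text \<open>No differentiability is assumed: \<open>frechet_derivative\<close> is a choice among all
  derivatives at the point, and two functions that agree near \<open>x\<close> have the same
  derivatives there, so the choices coincide.\<close>

lemma partial_deriv_cong_open:
  assumes "open S" "x \<in> S" "\<And>y. y \<in> S \<Longrightarrow> f y = g y"
  shows "partial_deriv i f x = partial_deriv i g x"
proof -
  have "(f has_derivative f') (at x) \<longleftrightarrow> (g has_derivative f') (at x)" for f'
    using has_derivative_transform_within_open[OF _ assms(1,2)] assms(3) by metis
  then show ?thesis by (simp add: partial_deriv_def frechet_derivative_def)
qed

lemma C_k_Suc_differentiable: "C_k (Suc k) f \<Longrightarrow> f differentiable at x"
  by (simp add: differentiable_on_def)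

lemma C_k_Suc_D: "C_k (Suc k) f \<Longrightarrow> C_k k f"
proof (induction k arbitrary: f)
  case 0
  then show ?case by (simp add: differentiable_imp_continuous_on)
next
  case (Suc k)
  then have "\<forall>i. C_k k (partial_deriv i f)" by (metis C_k.simps(2))
  with Suc.prems show ?case by simp
qed

lemma C_k_continuous: "C_k k f \<Longrightarrow> continuous_on UNIV f"
  by (cases k) (auto simp: differentiable_imp_continuous_on)

lemma C_k_const: "C_k k (\<lambda>x. c)"
proof (induction k arbitrary: c)
  case (Suc k)
  then show ?case by (simp add: partial_deriv_const)
qed simp

lemma C_k_add: "C_k k f \<Longrightarrow> C_k k g \<Longrightarrow> C_k k (\<lambda>x. f x + g x)"
proof (induction k arbitrary: f g)
  case (Suc k)
  have "partial_deriv i (\<lambda>x. f x + g x) = (\<lambda>x. partial_deriv i f x + partial_deriv i g x)" for i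
    using Suc.prems[THEN C_k_Suc_differentiable] by (intro ext partial_deriv_add)
  then show ?case using Suc by (simp add: differentiable_on_def)
qed (simp add: continuous_on_add)

lemma C_k_mult: "C_k k f \<Longrightarrow> C_k k g \<Longrightarrow> C_k k (\<lambda>x. f x * g x)"
proof (induction k arbitrary: f g)
  case (Suc k)
  have *: "partial_deriv i (\<lambda>x. f x * g x) =
      (\<lambda>x. partial_deriv i f x * g x + f x * partial_deriv i g x)" for i
    using Suc.prems[THEN C_k_Suc_differentiable] by (intro ext partial_deriv_mult)
  have "C_k k (\<lambda>x. partial_deriv i f x * g x + f x * partial_deriv i g x)" for i
    using Suc.prems Suc.prems[THEN C_k_Suc_D] by (intro C_k_add Suc.IH) auto
  then show ?case using Suc.prems by (simp add: * differentiable_on_def)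
qed (simp add: continuous_on_mult)

text \<open>\<open>D\<close> lists the successive derivatives of the outer function. The chain rule
  turns \<open>D m\<close> into \<open>D (Suc m)\<close> times a partial derivative of
  \<open>f\<close>, so the induction on \<open>k\<close> has to let \<open>m\<close> vary and closes
  by \<open>C_k_mult\<close>.\<close>

lemma C_k_compose:
  assumes "\<And>j s. s \<in> S \<Longrightarrow> (D j has_real_derivative D (Suc j) s) (at s)"
    and "\<And>x. f x \<in> S" and "C_k k f"
  shows "C_k k (\<lambda>x. D m (f x))"
  using assms(3)
proof (induction k arbitrary: m)
  case 0
  have "continuous_on (range f) (D m)"
    using assms(1,2) DERIV_isCont by (intro continuous_at_imp_continuous_on) blast
  with 0 show ?case by (simp add: continuous_on_compose2[of "range f"])
next
  case (Suc k)
  have *: "partial_deriv i (\<lambda>x. D m (f x)) = (\<lambda>x. D (Suc m) (f x) * partial_deriv i f x)" for i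
    using C_k_Suc_differentiable[OF Suc.prems] assms(1,2) by (intro ext partial_deriv_compose) auto
  have "(\<lambda>x. D m (f x)) differentiable at x" for x
    unfolding differentiable_def
    using has_derivative_real_compose[OF C_k_Suc_differentiable[OF Suc.prems] assms(1)[OF assms(2)]]
    by blast
  moreover have "C_k k (\<lambda>x. D (Suc m) (f x) * partial_deriv i f x)" for i
    using Suc.prems C_k_Suc_D[OF Suc.prems] by (intro C_k_mult Suc.IH) auto
  ultimately show ?case by (simp add: * differentiable_on_def)
qed

text \<open>The j-th derivative of a real power carries a falling factorial; this is the sequence
  \<open>D\<close> for \<open>C_k_compose\<close>.\<close>

lemma has_real_derivative_powr_iterated:
  fixes s a :: real and j :: nat
  assumes "s > 0"
  shows "((\<lambda>s. (\<Prod>i<j. a - real i) * s powr (a - real j)) has_real_derivative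
    (\<Prod>i<Suc j. a - real i) * s powr (a - real (Suc j))) (at s)"
proof -
  have "((\<lambda>s. s powr (a - j)) has_real_derivative (a - j) * s powr (a - j - 1)) (at s)"
    using assms by (rule has_real_derivative_powr)
  from DERIV_cmult[OF this, of "\<Prod>i<j. a - real i"] show ?thesis
    by (simp add: algebra_simps)
qed

lemma C_k_powr:
  assumes "\<And>x. f x > (0::real)" "C_k k f"
  shows "C_k k (\<lambda>x. f x powr a)"
  using C_k_compose[where D="\<lambda>j s. (\<Prod>i<j. a - real i) * s powr (a - real j)" and S="{0<..}"
      and m=0 and f=f and k=k, OF has_real_derivative_powr_iterated] assms by simp

lemma C_k_divide:
  assumes "\<And>x. g x > 0" "C_k k f" "C_k k g"
  shows "C_k k (\<lambda>x. f x / g x)"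
  using C_k_mult[OF assms(2) C_k_powr[OF assms(1,3), of "-1"]] assms(1)
  by (simp add: powr_minus divide_inverse less_imp_le)

section \<open>Derivatives of the squared distance and of the coordinates\<close>

lemma has_derivative_norm_diff_sq:
  fixes c :: "'a::real_inner"
  shows "((\<lambda>x. (norm (x - c))\<^sup>2) has_derivative (\<lambda>h. 2 * ((x - c) \<bullet> h))) (at x)"
  unfolding power2_norm_eq_inner
  by (auto intro!: derivative_eq_intros simp: inner_commute)

lemma partial_deriv_norm_diff_sq:
  "partial_deriv i (\<lambda>x. (norm (x - c))\<^sup>2) = (\<lambda>x. 2 * ((x - c) $ i))"
  by (rule ext, subst partial_deriv_eqI[OF has_derivative_norm_diff_sq]) (simp add: inner_axis)

lemma has_derivative_nth_diff:
  "((\<lambda>x::real^'n. (x - c) $ i) has_derivative (\<lambda>h. h $ i)) (at x)"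
  by (auto intro!: derivative_eq_intros bounded_linear_vec_nth bounded_linear.has_derivative[OF bounded_linear_vec_nth])

lemma partial_deriv_nth_diff:
  "partial_deriv j (\<lambda>x. (x - c) $ i) = (\<lambda>x. if i = j then 1 else 0)"
  by (rule ext, subst partial_deriv_eqI[OF has_derivative_nth_diff]) (simp add: axis_def)

lemma C_k_nth_diff: "C_k k (\<lambda>x. (x - c) $ i)"
proof (cases k)
  case (Suc m)
  then show ?thesis using has_derivative_nth_diff[of c i]
    by (auto simp: partial_deriv_nth_diff C_k_const differentiable_on_def differentiable_def
        simp del: vector_minus_component)
qed (auto intro!: continuous_intros)

lemma C_k_norm_diff_sq: "C_k k (\<lambda>x. (norm (x - c))\<^sup>2)"
proof (cases k)
  case (Suc m)
  have "C_k m (\<lambda>x. 2 * ((x - c) $ i))" for i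
    by (intro C_k_mult C_k_const C_k_nth_diff)
  then show ?thesis using has_derivative_norm_diff_sq[of c] Suc
    by (auto simp: partial_deriv_norm_diff_sq differentiable_on_def differentiable_def)
qed (auto intro!: continuous_intros)

subsection \<open>Smooth cutoff functions\<close>

text \<open>The power of w makes the induction work: \<open>pCons c p\<close> evaluates to c plus w
  times \<open>p\<close>, which raises the exponent by one.\<close>

lemma tendsto_power_poly_exp:
  "((\<lambda>w::real. w ^ m * poly p w * exp (- w)) \<longlongrightarrow> 0) at_top"
proof (induction p arbitrary: m)
  case (pCons c p)
  have "((\<lambda>w::real. c * (w ^ m / exp w) + w ^ Suc m * poly p w * exp (- w)) \<longlongrightarrow> c * 0 + 0) at_top"
    by (intro tendsto_intros tendsto_power_div_exp_0 pCons.IH)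
  then show ?case by (simp add: algebra_simps exp_minus divide_inverse)
qed simp

text \<open>The classical flat function exp(-1/t), extended by zero, with a polynomial in 1/t in
  front. The prefactor makes the family closed under differentiation.\<close>

definition flat_exp :: "real poly \<Rightarrow> real \<Rightarrow> real" where
  "flat_exp p t = (if t > 0 then poly p (1 / t) * exp (- (1 / t)) else 0)"

text \<open>For t > 0 the product rule gives t^(-2) (p - p')(1/t) exp(-1/t), hence the polynomial
  X^2 (p - p'). Only t = 0 needs a limit argument.\<close>

lemma has_real_derivative_flat_exp:
  "(flat_exp p has_real_derivative flat_exp (monom 1 2 * (p - pderiv p)) t) (at t)"
proof (cases t "0::real" rule: linorder_cases)
  case less
  have "((\<lambda>t. 0) has_real_derivative 0) (at t)" by simp
  then have "(flat_exp p has_real_derivative 0) (at t)"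
    by (rule has_field_derivative_transform_within_open[where S="{..<0}"])
      (use less in \<open>auto simp: flat_exp_def\<close>)
  with less show ?thesis by (simp add: flat_exp_def)
next
  case greater
  have "((\<lambda>t. poly p (1 / t) * exp (- (1 / t))) has_real_derivative
      flat_exp (monom 1 2 * (p - pderiv p)) t) (at t)"
    using greater unfolding flat_exp_def
    by (auto intro!: derivative_eq_intros DERIV_chain2[OF poly_DERIV]
        simp: poly_monom power2_eq_square field_simps)
  then show ?thesis
    by (rule has_field_derivative_transform_within_open[where S="{0<..}"])
      (use greater in \<open>auto simp: flat_exp_def\<close>)
next
  case equal
  have right: "((\<lambda>h. flat_exp p h / h) \<longlongrightarrow> 0) (at_right 0)"
  proof -
    \<comment> \<open>The difference quotient at 0 is w p(w) exp(-w) with w = 1/h; dividing by h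
      accounts for the exponent 1.\<close>
    have "((\<lambda>h::real. (1 / h) ^ 1 * poly p (1 / h) * exp (- (1 / h))) \<longlongrightarrow> 0) (at_right 0)"
      using filterlim_compose[OF tendsto_power_poly_exp filterlim_inverse_at_top_right, of 1 p]
      by (simp add: inverse_eq_divide)
    then show ?thesis
      by (rule Lim_transform_eventually)
        (auto simp: eventually_at_filter flat_exp_def)
  qed
  have "((\<lambda>h. flat_exp p h / h) \<longlongrightarrow> 0) (at_left 0)"
    by (rule tendsto_eventually) (auto simp: eventually_at_filter flat_exp_def)
  with right have "((\<lambda>h. flat_exp p h / h) \<longlongrightarrow> 0) (at 0)"
    by (simp add: filterlim_split_at)
  with equal show ?thesis by (simp add: DERIV_def flat_exp_def)
qed

lemma C_k_flat_exp:
  assumes "C_k k f"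
  shows "C_k k (\<lambda>x. flat_exp 1 (f x))"
proof -
  \<comment> \<open>The iterates of p -> X^2 (p - p') from 1 are the prefactors of the successive
    derivatives of exp(-1/t).\<close>
  let ?P = "\<lambda>j. ((\<lambda>p. monom 1 2 * (p - pderiv p)) ^^ j) 1"
  show ?thesis
    using C_k_compose[where D="\<lambda>j. flat_exp (?P j)" and m=0 and S=UNIV and f=f and k=k]
      has_real_derivative_flat_exp assms by simp
qed

text \<open>With f = |x-a|^2 / r^2, smooth also at the centre, take the quotient E(2-f) / (E(2-f) +
  E(f-1)), where E is the flat exponential. The arguments add up to 1, so one of them is positive
  and the denominator never vanishes. For f <= 1 the second term is 0, for f >= 2 the numerator
  is.\<close>

lemma smooth_cutoff:
  fixes a :: "real^'n"
  assumes "r > 0"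
  obtains \<zeta> where "\<And>k. C_k k \<zeta>" "\<And>x. x \<in> ball a r \<Longrightarrow> \<zeta> x = 1"
    "\<And>x. x \<notin> cball a (2 * r) \<Longrightarrow> \<zeta> x = 0"
proof
  define f where "f x = (norm (x - a))\<^sup>2 * (1 / r\<^sup>2)" for x
  let ?\<zeta> = "\<lambda>x. flat_exp 1 (2 - f x) / (flat_exp 1 (2 - f x) + flat_exp 1 (f x - 1))"
  have f: "C_k k f" for k
    unfolding f_def by (intro C_k_mult C_k_const C_k_norm_diff_sq)
  have 1: "C_k k (\<lambda>x. flat_exp 1 (2 - f x))" for k
    using C_k_flat_exp[OF C_k_add[OF C_k_const[of k 2] C_k_mult[OF C_k_const[of k "-1"] f]]]
    by simp
  have 2: "C_k k (\<lambda>x. flat_exp 1 (f x - 1))" for k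
    using C_k_flat_exp[OF C_k_add[OF f C_k_const[of k "-1"]]] by simp
  have pos: "flat_exp 1 (2 - f x) + flat_exp 1 (f x - 1) > 0" for x
    by (auto simp: flat_exp_def add_pos_nonneg add_nonneg_pos)
  show "C_k k ?\<zeta>" for k
    by (intro C_k_divide C_k_add 1 2 pos)
  show "?\<zeta> x = 1" if "x \<in> ball a r" for x
  proof -
    have "(norm (x - a))\<^sup>2 \<le> r\<^sup>2"
      using that by (intro power_mono) (auto simp: dist_norm norm_minus_commute)
    then have "f x \<le> 1" using assms by (simp add: f_def field_simps)
    then have "flat_exp 1 (f x - 1) = 0" by (simp add: flat_exp_def)
    with pos[of x] show ?thesis by simp
  qed
  show "?\<zeta> x = 0" if "x \<notin> cball a (2 * r)" for x
  proof -
    have "(2 * r)\<^sup>2 \<le> (norm (x - a))\<^sup>2"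
      using that assms by (intro power_mono) (auto simp: dist_norm norm_minus_commute)
    then have "4 \<le> f x" using assms by (simp add: f_def field_simps)
    then show ?thesis by (simp add: flat_exp_def)
  qed
qed

subsection \<open>The regularized fundamental solution\<close>

lemma iter_partial_deriv_cong_open:
  assumes "open S" "x \<in> S" "\<And>y. y \<in> S \<Longrightarrow> f y = g y"
  shows "iter_partial_deriv is f x = iter_partial_deriv is g x"
  using assms(2)
  by (induction "is" arbitrary: x) (auto simp: assms(3) intro: partial_deriv_cong_open[OF assms(1)])

lemma C_k_iter_partial_deriv: "C_k (length is + k) f \<Longrightarrow> C_k k (iter_partial_deriv is f)"
proof (induction "is" arbitrary: k)
  case (Cons i "is")
  have "C_k (Suc k) (iter_partial_deriv is f)"
    using Cons.IH[of "Suc k"] Cons.prems by (simp del: C_k.simps)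
  then show ?case by simp
qed simp

text \<open>Each second derivative has the same shape, with the square of one coordinate in place of
  \<open>N y\<close> in its first term. Summation turns these squares into \<open>N y\<close> and
  counts the other term \<open>CARD('n)\<close> times.\<close>

lemma laplacian_norm_powr:
  fixes x y :: "real^'n" and m b :: real
  assumes "m > 0"
  defines "N \<equiv> \<lambda>y. (norm (y - x))\<^sup>2"
  shows "(\<Sum>i\<in>UNIV. iter_partial_deriv [i, i] (\<lambda>y. (N y + m) powr b) y) =
    2 * b * (2 * (b - 1) * N y + CARD('n) * (N y + m)) * (N y + m) powr (b - 2)"
proof -
  have pos: "N z + m > 0" for z using assms by (simp add: N_def add_nonneg_pos)
  have C: "C_k k (\<lambda>y. N y + m)" for k
    unfolding N_def by (intro C_k_add C_k_norm_diff_sq C_k_const)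
  have diff: "(\<lambda>y. N y + m) differentiable at z" for z
    using C[of "Suc 0"] by (rule C_k_Suc_differentiable)
  have N': "partial_deriv i (\<lambda>y. N y + m) z = 2 * (z - x) $ i" for i z
    unfolding N_def
    by (subst partial_deriv_add[OF C_k_Suc_differentiable[OF C_k_norm_diff_sq] differentiable_const])
      (simp add: partial_deriv_const partial_deriv_norm_diff_sq)
  have powr': "partial_deriv i (\<lambda>y. (N y + m) powr c) z = (c * (N z + m) powr (c - 1)) * (2 * (z - x) $ i)"
    for i z c
    unfolding N'[symmetric]
    by (rule partial_deriv_compose[OF diff has_real_derivative_powr[OF pos]])
  have "iter_partial_deriv [i, i] (\<lambda>y. (N y + m) powr b) y =
      2 * b * (2 * (b - 1) * ((y - x) $ i)\<^sup>2 + (N y + m)) * (N y + m) powr (b - 2)" for i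
  proof -
    have lin: "C_k k (\<lambda>z. 2 * b * (z - x) $ i)" for k
      by (intro C_k_mult C_k_const C_k_nth_diff)
    have lin': "partial_deriv i (\<lambda>z. 2 * b * (z - x) $ i) y = 2 * b"
      by (subst partial_deriv_mult[OF differentiable_const C_k_Suc_differentiable[OF C_k_nth_diff]])
        (simp add: partial_deriv_const partial_deriv_nth_diff del: vector_minus_component)
    have "partial_deriv i (\<lambda>y. (N y + m) powr b) = (\<lambda>z. (2 * b * (z - x) $ i) * (N z + m) powr (b - 1))"
      by (rule ext) (simp add: powr' mult_ac del: vector_minus_component)
    then have "iter_partial_deriv [i, i] (\<lambda>y. (N y + m) powr b) y =
        partial_deriv i (\<lambda>z. (2 * b * (z - x) $ i) * (N z + m) powr (b - 1)) y"
      by simp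
    also have "\<dots> = 2 * b * (N y + m) powr (b - 1) +
        (2 * b * (y - x) $ i) * (((b - 1) * (N y + m) powr (b - 2)) * (2 * (y - x) $ i))"
      by (subst partial_deriv_mult)
        (use C_k_Suc_differentiable[OF lin] C_k_Suc_differentiable[OF C_k_powr[OF pos C]] in
          \<open>auto simp: lin' powr' simp del: vector_minus_component\<close>)
    also have "(N y + m) powr (b - 1) = (N y + m) * (N y + m) powr (b - 2)"
      using pos[of y] powr_add[of "N y + m" 1 "b - 2"] by simp
    finally show ?thesis by (simp add: algebra_simps power2_eq_square)
  qed
  moreover have "N y = (\<Sum>i\<in>UNIV. ((y - x) $ i)\<^sup>2)"
    unfolding N_def power2_norm_eq_inner by (simp add: inner_vec_def power2_eq_square)
  ultimately show ?thesis
    by (simp add: sum_distrib_left[symmetric] sum_distrib_right[symmetric] sum.distrib)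
qed

text \<open>This is e^(-n) k(z/e) for the k of the overview, with the division by e cleared; thus
  \<open>newton_kernel 1\<close> is k itself. The scaling is recovered in
  \<open>newton_kernel_scale\<close>.\<close>

definition newton_kernel :: "real \<Rightarrow> real^'n::finite \<Rightarrow> real" where
  "newton_kernel e z = real (CARD('n)) * (real (CARD('n)) - 2) * e\<^sup>2 *
     ((norm z)\<^sup>2 + e\<^sup>2) powr (- (real (CARD('n)) / 2) - 1)"

text \<open>The exponent b = 1 - n/2 is the one with 2 (b - 1) = -n: the terms in |y-x|^2 cancel and
  only n e^2 survives, times 2 b = -(n - 2).\<close>

lemma laplacian_regularized_fundamental_solution:
  fixes x y :: "real^'n"
  assumes "e > 0"
  shows "(\<Sum>i\<in>UNIV. iter_partial_deriv [i, i]
      (\<lambda>y. ((norm (y - x))\<^sup>2 + e\<^sup>2) powr (1 - CARD('n) / 2)) y) = - newton_kernel e (x - y)"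
proof -
  have "1 - real CARD('n) / 2 - 2 = - (real CARD('n) / 2) - 1" by simp
  with assms show ?thesis
    unfolding newton_kernel_def norm_minus_commute[of x y]
    by (simp only: laplacian_norm_powr[of "e\<^sup>2"] zero_less_power) (simp add: algebra_simps)
qed

text \<open>The exponent is not positive, so dropping e^2 increases the power. The pole is excluded
  because in dimension above 2 the right side there is 1/0 = 0.\<close>

lemma regularized_fundamental_solution_le:
  fixes x y :: "real^'n"
  assumes "CARD('n) \<ge> 2" "x \<noteq> y"
  shows "((norm (y - x))\<^sup>2 + e\<^sup>2) powr (1 - CARD('n) / 2) \<le> 1 / norm (x - y) ^ (CARD('n) - 2)"
proof -
  have pos: "norm (x - y) > 0" using assms by simp
  have "((norm (y - x))\<^sup>2 + e\<^sup>2) powr (1 - CARD('n) / 2) \<le> ((norm (x - y))\<^sup>2) powr (1 - CARD('n) / 2)"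
    using assms pos by (intro powr_mono2') (auto simp: norm_minus_commute)
  also have "\<dots> = norm (x - y) powr (- real (CARD('n) - 2))"
    unfolding powr_numeral[OF pos[THEN less_imp_le], symmetric] powr_powr
    using assms(1) by (simp add: of_nat_diff)
  also have "\<dots> = 1 / norm (x - y) ^ (CARD('n) - 2)"
    using pos by (simp add: powr_minus powr_realpow inverse_eq_divide)
  finally show ?thesis .
qed

section \<open>Local integrability, and the tested equation\<close>

lemma continuous_imp_lebesgue_measurable:
  fixes f :: "'a::euclidean_space \<Rightarrow> 'b::topological_space"
  assumes "continuous_on UNIV f"
  shows "f \<in> borel_measurable lebesgue"
  using measurable_completion[of f lborel borel] borel_measurable_continuous_onI[OF assms] by simp

text \<open>The truncations to the balls of radius n are measurable, and at each point they are
  eventually equal to \<open>f\<close>.\<close>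

lemma locally_integrable_measurable:
  assumes "locally_integrable f"
  shows "f \<in> borel_measurable lebesgue"
proof (rule borel_measurable_LIMSEQ_metric)
  show "(\<lambda>x. indicator (cball 0 (real n)) x *\<^sub>R f x) \<in> borel_measurable lebesgue" for n
    using assms unfolding locally_integrable_def set_integrable_def
    by (intro borel_measurable_integrable) simp
  show "(\<lambda>n. indicator (cball 0 (real n)) x *\<^sub>R f x) \<longlonglongrightarrow> f x" for x
  proof (rule tendsto_eventually)
    show "eventually (\<lambda>n. indicator (cball 0 (real n)) x *\<^sub>R f x = f x) sequentially"
      using eventually_ge_at_top[of "nat \<lceil>norm x\<rceil>"]
      by eventually_elim (auto simp: indicator_def nat_le_iff ceiling_le_iff)
  qed
qed

text \<open>Vanishing off \<open>K\<close> is asked of the product, so that either factor may supply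
  the compact support: the test function or the locally integrable function.\<close>

lemma integrable_continuous_scaleR_locally_integrable:
  fixes f :: "real^'n \<Rightarrow> complex"
  assumes f: "locally_integrable f" and \<psi>: "continuous_on UNIV \<psi>" and K: "compact K"
    and zero: "AE x in lebesgue. x \<notin> K \<longrightarrow> \<psi> x *\<^sub>R f x = 0"
  shows "integrable lebesgue (\<lambda>x. \<psi> x *\<^sub>R f x)"
proof -
  have "bounded (\<psi> ` K)"
    using K \<psi> by (intro compact_imp_bounded compact_continuous_image) (auto intro: continuous_on_subset)
  then obtain M where M: "\<And>x. x \<in> K \<Longrightarrow> norm (\<psi> x) \<le> M" unfolding bounded_iff by auto
  have [measurable]: "f \<in> borel_measurable lebesgue" by (rule locally_integrable_measurable[OF f])
  have [measurable]: "\<psi> \<in> borel_measurable lebesgue"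
    by (rule continuous_imp_lebesgue_measurable[OF \<psi>])
  have int: "integrable lebesgue (\<lambda>x. M *\<^sub>R (indicator K x *\<^sub>R f x))"
    using f K unfolding locally_integrable_def set_integrable_def
    by (intro integrable_scaleR_right) blast
  have "AE x in lebesgue. norm (\<psi> x *\<^sub>R f x) \<le> norm (M *\<^sub>R (indicator K x *\<^sub>R f x))"
    using zero
  proof eventually_elim
    case (elim x)
    show ?case
      using elim M[of x] by (cases "x \<in> K") (auto intro!: mult_right_mono)
  qed
  then show ?thesis by (rule Bochner_Integration.integrable_bound[OF int, rotated]) measurable
qed

lemma locally_integrable_integrable:
  assumes "locally_integrable f" "AE x in lebesgue. x \<notin> ball a r \<longrightarrow> f x = 0"
  shows "integrable lebesgue f"
proof -
  have "AE x in lebesgue. x \<notin> cball a r \<longrightarrow> 1 *\<^sub>R f x = 0"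
    using assms(2) by eventually_elim auto
  from integrable_continuous_scaleR_locally_integrable[OF assms(1) continuous_on_const compact_cball this]
  show ?thesis by simp
qed

text \<open>The test function depends on x, and so the bound holds at every x and not merely almost
  everywhere. \<open>L\<close> stands for the Laplacian, of which only the tested equation and the
  support enter.\<close>

lemma norm_newton_kernel_integral_le:
  fixes u L :: "real^'n \<Rightarrow> complex"
  assumes n: "CARD('n) \<ge> 2" and e: "e > 0" and r: "r > 0"
    and u: "locally_integrable u" and u0: "AE x in lebesgue. x \<notin> ball a r \<longrightarrow> u x = 0"
    and L: "locally_integrable L" and L0: "AE x in lebesgue. x \<notin> ball a r \<longrightarrow> L x = 0"
    and weak: "\<And>\<phi>. \<phi> \<in> test_functions \<Longrightarrow>
      (LINT x|lebesgue. (\<Sum>i\<in>UNIV. iter_partial_deriv [i, i] \<phi> x) *\<^sub>R u x) = (LINT x|lebesgue. \<phi> x *\<^sub>R L x)"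
  shows "ennreal (norm (LINT y|lebesgue. newton_kernel e (x - y) *\<^sub>R u y)) \<le>
    (\<integral>\<^sup>+y. ennreal (norm (L y) / norm (x - y) ^ (CARD('n) - 2)) \<partial>lebesgue)"
proof -
  obtain \<zeta> where \<zeta>: "\<And>k. C_k k \<zeta>" "\<And>x. x \<in> ball a r \<Longrightarrow> \<zeta> x = 1"
    "\<And>x. x \<notin> cball a (2 * r) \<Longrightarrow> \<zeta> x = 0" using smooth_cutoff[OF r] by metis
  define F where "F y = ((norm (y - x))\<^sup>2 + e\<^sup>2) powr (1 - real CARD('n) / 2)" for y
  define \<phi> where "\<phi> y = \<zeta> y * F y" for y
  have F: "C_k k F" for k
    unfolding F_def using e by (intro C_k_powr C_k_add C_k_norm_diff_sq C_k_const) (auto simp: add_nonneg_pos)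
  have \<phi>: "C_k k \<phi>" for k
    unfolding \<phi>_def by (intro C_k_mult \<zeta> F)
  have "closure {x. \<phi> x \<noteq> 0} \<subseteq> cball a (2 * r)"
    using \<zeta>(3) by (intro closure_minimal) (auto simp: \<phi>_def simp del: mem_cball)
  then have test: "\<phi> \<in> test_functions"
    using \<phi> by (auto simp: test_functions_def compact_eq_bounded_closed intro: bounded_subset[OF bounded_cball])
  \<comment> \<open>On the open ball the cutoff is constantly 1, so \<open>\<phi>\<close> and
    \<open>F\<close> have the same derivatives there and no derivative of the cutoff
    appears.\<close>
  have lap: "(\<Sum>i\<in>UNIV. iter_partial_deriv [i, i] \<phi> y) = - newton_kernel e (x - y)"
    if "y \<in> ball a r" for y
    unfolding laplacian_regularized_fundamental_solution[OF e, symmetric]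
    using that by (intro sum.cong refl iter_partial_deriv_cong_open[of "ball a r"])
      (auto simp: \<phi>_def \<zeta>(2) F_def simp del: mem_ball)
  have [measurable]: "u \<in> borel_measurable lebesgue" "L \<in> borel_measurable lebesgue"
    using u L by (auto intro: locally_integrable_measurable)
  have cont: "continuous_on UNIV \<phi>" "continuous_on UNIV (iter_partial_deriv [i, i] \<phi>)" for i
    using C_k_continuous[OF \<phi>] C_k_continuous[OF C_k_iter_partial_deriv[of "[i,i]" 0 \<phi>]] \<phi> by auto
  have kernel: "continuous_on UNIV (\<lambda>y. newton_kernel e (x - y))"
    unfolding newton_kernel_def using e
    by (intro continuous_intros) (auto simp: add_nonneg_eq_0_iff)
  note [measurable] = continuous_imp_lebesgue_measurable[OF cont(1)]
    continuous_imp_lebesgue_measurable[OF cont(2)] continuous_imp_lebesgue_measurable[OF kernel]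
  have "(LINT y|lebesgue. newton_kernel e (x - y) *\<^sub>R u y) =
      - (LINT y|lebesgue. (- newton_kernel e (x - y)) *\<^sub>R u y)" by simp
  also have "(LINT y|lebesgue. (- newton_kernel e (x - y)) *\<^sub>R u y) =
      (LINT y|lebesgue. (\<Sum>i\<in>UNIV. iter_partial_deriv [i, i] \<phi> y) *\<^sub>R u y)"
  proof (rule integral_cong_AE)
    show "AE y in lebesgue. (- newton_kernel e (x - y)) *\<^sub>R u y =
        (\<Sum>i\<in>UNIV. iter_partial_deriv [i, i] \<phi> y) *\<^sub>R u y"
      using u0
    proof eventually_elim
      case (elim y)
      then show ?case using lap by (cases "y \<in> ball a r") (simp_all only: scaleR_zero_right simp_thms)
    qed
  qed measurable
  also have "\<dots> = (LINT y|lebesgue. \<phi> y *\<^sub>R L y)" by (rule weak[OF test])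
  finally have eq: "norm (LINT y|lebesgue. newton_kernel e (x - y) *\<^sub>R u y) = norm (LINT y|lebesgue. \<phi> y *\<^sub>R L y)"
    by simp
  have "integrable lebesgue (\<lambda>y. \<phi> y *\<^sub>R L y)"
  proof (rule integrable_continuous_scaleR_locally_integrable[OF L cont(1) compact_cball])
    show "AE y in lebesgue. y \<notin> cball a r \<longrightarrow> \<phi> y *\<^sub>R L y = 0"
      using L0 by eventually_elim auto
  qed
  then have "ennreal (norm (LINT y|lebesgue. \<phi> y *\<^sub>R L y)) \<le> (\<integral>\<^sup>+y. norm (\<phi> y *\<^sub>R L y) \<partial>lebesgue)"
    by (rule integral_norm_bound_ennreal)
  also have "\<dots> \<le> (\<integral>\<^sup>+y. ennreal (norm (L y) / norm (x - y) ^ (CARD('n) - 2)) \<partial>lebesgue)"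
  proof (rule nn_integral_mono_AE)
    \<comment> \<open>The pole is a null set; it must be left out because the kernel takes the value
      0 there by division by zero.\<close>
    have "AE y in lebesgue. y \<noteq> x"
      by (intro AE_completion AE_lborel_singleton)
    with L0 show "AE y in lebesgue. ennreal (norm (\<phi> y *\<^sub>R L y)) \<le> ennreal (norm (L y) / norm (x - y) ^ (CARD('n) - 2))"
    proof eventually_elim
      case (elim y)
      show ?case
      proof (cases "y \<in> ball a r")
        case True
        then have "norm (\<phi> y *\<^sub>R L y) = F y * norm (L y)"
          by (simp add: \<phi>_def \<zeta>(2) F_def)
        also have "\<dots> \<le> (1 / norm (x - y) ^ (CARD('n) - 2)) * norm (L y)"
          unfolding F_def using elim n by (intro mult_right_mono regularized_fundamental_solution_le) auto
        finally show ?thesis by (intro ennreal_leI) simp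
      qed (use elim in simp)
    qed
  qed
  finally show ?thesis by (simp add: eq)
qed

subsection \<open>Approximation in the mean by continuous functions\<close>

text \<open>Outer regularity of \<open>A\<close> and of its complement encloses \<open>A\<close>
  between the closed set \<open>- W\<close> and the open set \<open>U\<close>. A Urysohn function
  that is 1 on \<open>- W\<close> and 0 off \<open>U\<close> differs from the indicator only on
  \<open>U - A\<close> and \<open>W - - A\<close>, both of small measure.\<close>

lemma indicator_approx_continuous:
  fixes A :: "'a::euclidean_space set"
  assumes A: "A \<in> sets borel" "emeasure lborel A < \<infinity>" and e: "e > 0"
  obtains g :: "'a \<Rightarrow> real" where "continuous_on UNIV g" "\<And>x. 0 \<le> g x \<and> g x \<le> 1"
    "integrable lborel g" "(LINT x|lborel. \<bar>indicator A x - g x\<bar>) < e"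
proof -
  obtain U where U: "open U" "A \<subseteq> U" "emeasure lborel (U - A) < ennreal (e / 2)"
    using outer_regular_lborel[OF A(1), of "e / 2"] e by auto
  obtain W where W: "open W" "- A \<subseteq> W" "emeasure lborel (W - - A) < ennreal (e / 2)"
    using outer_regular_lborel[of "- A" "e / 2"] e A(1) by (auto simp: borel_comp)
  obtain g :: "'a \<Rightarrow> real" where g: "continuous_on UNIV g" "\<And>x. g x \<in> closed_segment 1 0"
    "\<And>x. x \<in> - W \<Longrightarrow> g x = 1" "\<And>x. x \<in> - U \<Longrightarrow> g x = 0"
  proof (rule Urysohn_local[of UNIV "- W" "- U" 1 0])
    show "closedin (top_of_set UNIV) (- W)" "closedin (top_of_set UNIV) (- U)"
      using U(1) W(1) by (auto simp: closed_Compl)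
    show "- W \<inter> - U = {}" using U(2) W(2) by auto
  qed auto
  have g01: "0 \<le> g x \<and> g x \<le> 1" for x
    using g(2)[of x] by (auto simp: closed_segment_eq_real_ivl)
  have [measurable]: "g \<in> borel_measurable borel" "U \<in> sets borel" "W \<in> sets borel"
    using g(1) U(1) W(1) by (auto intro: borel_measurable_continuous_onI)
  note [measurable] = A(1)
  have fin: "emeasure lborel (U - A) < \<infinity>" "emeasure lborel (W - - A) < \<infinity>"
    using U(3) W(3) by (auto intro: order_less_trans[OF _ ennreal_less_top])
  have "emeasure lborel U = emeasure lborel (A \<union> (U - A))"
    using U(2) by (intro arg_cong[where f="emeasure lborel"]) auto
  also have "\<dots> \<le> emeasure lborel A + emeasure lborel (U - A)"
    by (rule emeasure_subadditive) auto
  finally have "emeasure lborel U < \<infinity>"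
    using A(2) fin(1) by (auto simp: less_top[symmetric] top_unique)
  then have "integrable lborel (indicator U :: 'a \<Rightarrow> real)" by simp
  then have int: "integrable lborel g"
    by (rule Bochner_Integration.integrable_bound) (use g01 g(4) in \<open>auto split: split_indicator\<close>)
  have intA: "integrable lborel (indicator A :: 'a \<Rightarrow> real)" using A by simp
  have "\<bar>indicator A x - g x\<bar> \<le> indicator (U - A) x + indicator (W - - A) x" for x
    using g01[of x] g(3,4)[of x] U(2) W(2) by (auto split: split_indicator)
  then have "(LINT x|lborel. \<bar>indicator A x - g x\<bar>) \<le>
      (LINT x|lborel. indicator (U - A) x + indicator (W - - A) x)"
    using fin int intA by (intro integral_mono Bochner_Integration.integrable_add integrable_abs
      Bochner_Integration.integrable_diff) auto
  also have "\<dots> = measure lborel (U - A) + measure lborel (W - - A)"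
    using fin by (subst Bochner_Integration.integral_add) auto
  also have "\<dots> < e / 2 + e / 2"
    using U(3) W(3) e fin by (intro add_strict_mono) (auto simp: emeasure_eq_ennreal_measure ennreal_less_iff)
  finally show ?thesis using that g(1) g01 int by simp
qed

text \<open>Density of continuous functions in the mean, by induction over integrable functions.
  Boundedness is part of the claim because it later gives the dominating function for the
  mollifications of \<open>v\<close>.\<close>

lemma integrable_approx_continuous:
  fixes f :: "'a::euclidean_space \<Rightarrow> 'b::{banach, second_countable_topology}"
  assumes "integrable lborel f" "e > 0"
  shows "\<exists>v. continuous_on UNIV v \<and> bounded (range v) \<and> integrable lborel v \<and>
    (LINT x|lborel. norm (f x - v x)) < e"
  using assms
proof (induction arbitrary: e rule: integrable_induct)
  case (base A c)
  \<comment> \<open>The added 1 covers c = 0 and makes the final inequality strict.\<close>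
  define d where "d = e / (norm c + 1)"
  have nc: "norm c + 1 > 0" using norm_ge_zero[of c] by linarith
  then have d: "d > 0" using base by (simp add: d_def)
  obtain g :: "'a \<Rightarrow> real" where g: "continuous_on UNIV g" "\<And>x. 0 \<le> g x \<and> g x \<le> 1"
    "integrable lborel g" "(LINT x|lborel. \<bar>indicator A x - g x\<bar>) < d"
    using indicator_approx_continuous[of A d] base d by auto
  have "norm (indicator A x *\<^sub>R c - g x *\<^sub>R c) = \<bar>indicator A x - g x\<bar> * norm c" for x
    by (simp flip: scaleR_diff_left)
  then have "(LINT x|lborel. norm (indicator A x *\<^sub>R c - g x *\<^sub>R c)) =
      (LINT x|lborel. \<bar>indicator A x - g x\<bar>) * norm c" by simp
  also have "\<dots> \<le> d * norm c" using g(4) by (intro mult_right_mono) auto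
  also have "\<dots> < e" using base nc by (simp add: d_def field_simps)
  finally have *: "(LINT x|lborel. norm (indicator A x *\<^sub>R c - g x *\<^sub>R c)) < e" .
  have "norm (g x *\<^sub>R c) \<le> norm c" for x
    using g(2)[of x] mult_right_mono[of "g x" 1 "norm c"] by simp
  then have "bounded (range (\<lambda>x. g x *\<^sub>R c))" by (auto simp: bounded_iff)
  with * g show ?case by (intro exI[of _ "\<lambda>x. g x *\<^sub>R c"]) (auto intro!: continuous_intros)
next
  case (add f1 f2)
  obtain v1 where v1: "continuous_on UNIV v1" "bounded (range v1)" "integrable lborel v1"
    "(LINT x|lborel. norm (f1 x - v1 x)) < e / 2" using add.IH(1)[of "e / 2"] add.prems by auto
  obtain v2 where v2: "continuous_on UNIV v2" "bounded (range v2)" "integrable lborel v2"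
    "(LINT x|lborel. norm (f2 x - v2 x)) < e / 2" using add.IH(2)[of "e / 2"] add.prems by auto
  have "(LINT x|lborel. norm (f1 x + f2 x - (v1 x + v2 x))) \<le>
      (LINT x|lborel. norm (f1 x - v1 x) + norm (f2 x - v2 x))"
    using add v1 v2 by (intro integral_mono) (auto intro: norm_diff_triangle_ineq)
  also have "\<dots> < e" using add v1 v2 by (subst Bochner_Integration.integral_add) auto
  finally show ?case
    using v1 v2 by (intro exI[of _ "\<lambda>x. v1 x + v2 x"]) (auto intro!: continuous_intros bounded_plus_comp)
next
  case (lim f s)
  have [measurable]: "f \<in> borel_measurable borel" "\<And>i. s i \<in> borel_measurable borel"
    using lim.hyps by auto
  have "(\<lambda>i. LINT x|lborel. norm (f x - s i x)) \<longlonglongrightarrow> (LINT x|(lborel :: 'a measure). (0::real))"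
  proof (rule integral_dominated_convergence)
    \<comment> \<open>The induction principle provides simple functions bounded by twice the norm of
      \<open>f\<close>, whence the factor 1 + 2.\<close>
    show "integrable lborel (\<lambda>x. 3 * norm (f x))" using lim.hyps by simp
    show "AE x in lborel. (\<lambda>i. norm (f x - s i x)) \<longlonglongrightarrow> 0"
    proof (rule AE_I2)
      fix x :: 'a
      have "(\<lambda>i. norm (f x - s i x)) \<longlonglongrightarrow> norm (f x - f x)"
        using lim.hyps(2) by (intro tendsto_intros) simp
      then show "(\<lambda>i. norm (f x - s i x)) \<longlonglongrightarrow> 0" by simp
    qed
    show "AE x in lborel. norm (norm (f x - s i x)) \<le> 3 * norm (f x)" for i
    proof (rule AE_I2)
      fix x :: 'a
      have "norm (s i x) \<le> 2 * norm (f x)" using lim.hyps(3) by simp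
      with norm_triangle_ineq4[of "f x" "s i x"]
      show "norm (norm (f x - s i x)) \<le> 3 * norm (f x)" by simp
    qed
  qed measurable
  then have "eventually (\<lambda>i. (LINT x|lborel. norm (f x - s i x)) < e / 2) sequentially"
    using lim.prems by (intro order_tendstoD(2)[of _ 0]) auto
  then obtain i where i: "(LINT x|lborel. norm (f x - s i x)) < e / 2"
    by (auto simp: eventually_sequentially)
  obtain v where v: "continuous_on UNIV v" "bounded (range v)" "integrable lborel v"
    "(LINT x|lborel. norm (s i x - v x)) < e / 2" using lim.IH[of "e / 2" i] lim.prems by auto
  have "(LINT x|lborel. norm (f x - v x)) \<le>
      (LINT x|lborel. norm (f x - s i x) + norm (s i x - v x))"
    using lim.hyps v by (intro integral_mono) (auto intro: norm_diff_triangle_le[OF order_refl order_refl])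
  also have "\<dots> < e" using lim.hyps v i by (subst Bochner_Integration.integral_add) auto
  finally show ?case using v by blast
qed

subsection \<open>Approximate identities\<close>

lemma nn_integral_lborel_translate:
  fixes f :: "'a::euclidean_space \<Rightarrow> ennreal"
  assumes [measurable]: "f \<in> borel_measurable borel"
  shows "(\<integral>\<^sup>+x. f (x - c) \<partial>lborel) = (\<integral>\<^sup>+x. f x \<partial>lborel)"
proof -
  have "(\<integral>\<^sup>+x. f x \<partial>lborel) = (\<integral>\<^sup>+x. f x \<partial>distr lborel borel ((+) (- c)))"
    by (simp add: lborel_distr_plus)
  then show ?thesis by (simp add: nn_integral_distr)
qed

text \<open>Insert \<open>v\<close>: the mass times u(x) is the mollified u, plus the mass times (u
  - v)(x), plus the mollification error of v, minus the mollified u - v. The last term is kept as a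
  nonnegative integral because it may diverge at some x.\<close>

lemma approximate_identity_le:
  fixes u v :: "'a::euclidean_space \<Rightarrow> 'b::{banach, second_countable_topology}" and k :: "'a \<Rightarrow> real"
  assumes k: "integrable lborel k" "\<And>z. 0 \<le> k z"
    and [measurable]: "u \<in> borel_measurable borel"
    and v: "continuous_on UNIV v" "bounded (range v)"
  shows "ennreal ((LINT z|lborel. k z) * norm (u x)) \<le>
    ennreal (norm (LINT z|lborel. k z *\<^sub>R u (x - e *\<^sub>R z))) +
    (ennreal ((LINT z|lborel. k z) * norm (u x - v x)) +
      (ennreal (norm ((LINT z|lborel. k z) *\<^sub>R v x - (LINT z|lborel. k z *\<^sub>R v (x - e *\<^sub>R z)))) +
       (\<integral>\<^sup>+z. ennreal (k z * norm (u (x - e *\<^sub>R z) - v (x - e *\<^sub>R z))) \<partial>lborel)))"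
\<comment> \<open>An infinite last term makes the claim trivial; a finite one makes the integrand
  with u - v integrable, so that the Bochner integral may be split.\<close>
proof (cases "(\<integral>\<^sup>+z. ennreal (k z * norm (u (x - e *\<^sub>R z) - v (x - e *\<^sub>R z))) \<partial>lborel) = top")
  case False
  define \<kappa> where "\<kappa> = (LINT z|lborel. k z)"
  have \<kappa>: "\<kappa> \<ge> 0" unfolding \<kappa>_def using k by (intro Bochner_Integration.integral_nonneg) auto
  have [measurable]: "v \<in> borel_measurable borel" "k \<in> borel_measurable borel"
    using v(1) k(1) by (auto intro: borel_measurable_continuous_onI)
  obtain M where M: "\<And>x. norm (v x) \<le> M" using v(2) by (auto simp: bounded_iff)
  let ?w = "\<lambda>z. k z *\<^sub>R (u (x - e *\<^sub>R z) - v (x - e *\<^sub>R z))"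
  have w_norm: "norm (?w z) = k z * norm (u (x - e *\<^sub>R z) - v (x - e *\<^sub>R z))" for z
    using k(2) by simp
  have w: "integrable lborel ?w"
    unfolding integrable_iff_bounded w_norm using False by (auto simp: less_top)
  have kv: "integrable lborel (\<lambda>z. k z *\<^sub>R v (x - e *\<^sub>R z))"
  proof (rule Bochner_Integration.integrable_bound)
    show "integrable lborel (\<lambda>z. k z * M)" using k by simp
    show "AE z in lborel. norm (k z *\<^sub>R v (x - e *\<^sub>R z)) \<le> norm (k z * M)"
    proof (rule AE_I2)
      fix z
      show "norm (k z *\<^sub>R v (x - e *\<^sub>R z)) \<le> norm (k z * M)"
        using M[of "x - e *\<^sub>R z"] k(2)[of z] by (auto simp: abs_mult intro!: mult_left_mono)
    qed
  qed measurable
  have "(LINT z|lborel. k z *\<^sub>R u (x - e *\<^sub>R z)) =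
      (LINT z|lborel. k z *\<^sub>R v (x - e *\<^sub>R z)) + (LINT z|lborel. ?w z)"
    using kv w by (subst Bochner_Integration.integral_add[symmetric]) (simp_all add: scaleR_diff_right)
  then have "\<kappa> *\<^sub>R u x = (LINT z|lborel. k z *\<^sub>R u (x - e *\<^sub>R z)) + (\<kappa> *\<^sub>R (u x - v x) +
      ((\<kappa> *\<^sub>R v x - (LINT z|lborel. k z *\<^sub>R v (x - e *\<^sub>R z))) - (LINT z|lborel. ?w z)))"
    by (simp add: scaleR_diff_right)
  then have "\<kappa> * norm (u x) \<le> norm (LINT z|lborel. k z *\<^sub>R u (x - e *\<^sub>R z)) + (\<kappa> * norm (u x - v x) +
      (norm (\<kappa> *\<^sub>R v x - (LINT z|lborel. k z *\<^sub>R v (x - e *\<^sub>R z))) + norm (LINT z|lborel. ?w z)))"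
    using \<kappa> norm_triangle_ineq norm_triangle_ineq4
    by (smt (verit) norm_scaleR)
  then have "ennreal (\<kappa> * norm (u x)) \<le> ennreal (norm (LINT z|lborel. k z *\<^sub>R u (x - e *\<^sub>R z))) +
      (ennreal (\<kappa> * norm (u x - v x)) +
      (ennreal (norm (\<kappa> *\<^sub>R v x - (LINT z|lborel. k z *\<^sub>R v (x - e *\<^sub>R z)))) +
       ennreal (norm (LINT z|lborel. ?w z))))"
    using \<kappa> by (simp add: ennreal_plus[symmetric] del: ennreal_plus)
  also have "ennreal (norm (LINT z|lborel. ?w z)) \<le>
      (\<integral>\<^sup>+z. ennreal (k z * norm (u (x - e *\<^sub>R z) - v (x - e *\<^sub>R z))) \<partial>lborel)"
    using integral_norm_bound_ennreal[OF w] unfolding w_norm .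
  finally show ?thesis unfolding \<kappa>_def by (simp add: add_left_mono)
qed simp

text \<open>Tonelli, then translation invariance in x: the shift by e z does not change the inner
  integral, so the value is the same for every \<open>e\<close>.\<close>

lemma nn_integral_convolution_scaled:
  fixes g k :: "'a::euclidean_space \<Rightarrow> real"
  assumes k: "integrable lborel k" "\<And>z. 0 \<le> k z"
    and g: "integrable lborel g" "\<And>z. 0 \<le> g z"
  shows "(\<integral>\<^sup>+x. \<integral>\<^sup>+z. ennreal (k z * g (x - e *\<^sub>R z)) \<partial>lborel \<partial>lborel) =
    ennreal ((LINT z|lborel. k z) * (LINT x|lborel. g x))"
proof -
  have [measurable]: "k \<in> borel_measurable borel" "g \<in> borel_measurable borel" using k g by auto
  have "(\<integral>\<^sup>+x. \<integral>\<^sup>+z. ennreal (k z * g (x - e *\<^sub>R z)) \<partial>lborel \<partial>lborel) =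
      (\<integral>\<^sup>+z. \<integral>\<^sup>+x. ennreal (k z) * ennreal (g (x - e *\<^sub>R z)) \<partial>lborel \<partial>lborel)"
    using k g by (subst lborel_pair.Fubini') (simp_all add: ennreal_mult)
  also have "\<dots> = (\<integral>\<^sup>+z. ennreal (k z) * (\<integral>\<^sup>+x. ennreal (g x) \<partial>lborel) \<partial>lborel)"
    using nn_integral_lborel_translate[of "\<lambda>x. ennreal (g x)"] by (simp add: nn_integral_cmult)
  also have "\<dots> = ennreal (LINT z|lborel. k z) * ennreal (LINT x|lborel. g x)"
    using k g by (simp add: nn_integral_multc nn_integral_eq_integral)
  finally show ?thesis
    using k g by (simp add: ennreal_mult integral_nonneg)
qed

text \<open>The bound \<open>I\<close> may be infinite or fail to be locally integrable: only the nonnegative part of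
  \<open>\<kappa> \<bar>u\<bar> - I\<close> is integrated, and it is dominated by the error of the approximation.\<close>

lemma approximate_identity_bound:
  fixes u :: "'a::euclidean_space \<Rightarrow> 'b::{banach, second_countable_topology}" and k :: "'a \<Rightarrow> real"
  assumes u: "integrable lborel u" and k: "integrable lborel k" "\<And>z. 0 \<le> k z"
    and [measurable]: "I \<in> borel_measurable borel"
    and le: "\<And>e x. e > 0 \<Longrightarrow> ennreal (norm (LINT z|lborel. k z *\<^sub>R u (x - e *\<^sub>R z))) \<le> I x"
  shows "AE x in lborel. ennreal ((LINT z|lborel. k z) * norm (u x)) \<le> I x"
proof -
  define \<kappa> where "\<kappa> = (LINT z|lborel. k z)"
  have \<kappa>: "\<kappa> \<ge> 0" unfolding \<kappa>_def using k by (intro Bochner_Integration.integral_nonneg) auto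
  have [measurable]: "u \<in> borel_measurable borel" "k \<in> borel_measurable borel" using u k by auto
  have [measurable]: "ball (0::'a) R \<in> sets borel" for R by simp
  \<comment> \<open>The error for the continuous function is bounded and tends to 0 pointwise; on a
    ball, which has finite measure, dominated convergence applies. Balls of integer radius then
    exhaust the space.\<close>
  let ?X = "\<lambda>R. \<integral>\<^sup>+x. (ennreal (\<kappa> * norm (u x)) - I x) * indicator (ball 0 R) x \<partial>lborel"
  have "?X R \<le> 0 + ennreal \<epsilon>" if \<epsilon>: "\<epsilon> > 0" for R \<epsilon>
  proof -
    \<comment> \<open>The difference u - v contributes \<kappa> d twice, once at the point x and
      once mollified; the added 1 covers \<kappa> = 0.\<close>
    define d where "d = \<epsilon> / (2 * \<kappa> + 1)"
    have d: "d > 0" "2 * (\<kappa> * d) \<le> \<epsilon>" using \<epsilon> \<kappa> by (auto simp: d_def field_simps)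
    obtain v where v: "continuous_on UNIV v" "bounded (range v)" "integrable lborel v"
      "(LINT x|lborel. norm (u x - v x)) < d"
      using integrable_approx_continuous[OF u d(1)] by auto
    have [measurable]: "v \<in> borel_measurable borel" using v(1) by (rule borel_measurable_continuous_onI)
    obtain M where M: "\<And>x. norm (v x) \<le> M" using v(2) by (auto simp: bounded_iff)
    have M0: "M \<ge> 0" using order_trans[OF norm_ge_zero M] .
    define D where "D e x = norm (\<kappa> *\<^sub>R v x - (LINT z|lborel. k z *\<^sub>R v (x - e *\<^sub>R z)))" for e x
    have [measurable]: "D e \<in> borel_measurable borel" for e unfolding D_def by measurable
    have kv_bound: "norm (k z *\<^sub>R v y) \<le> k z * M" for z y
      using M[of y] k(2)[of z] by (auto intro!: mult_left_mono)
    have D_bound: "D e x \<le> 2 * \<kappa> * M" for e x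
    proof -
      have "norm (LINT z|lborel. k z *\<^sub>R v (x - e *\<^sub>R z)) \<le> (LINT z|lborel. k z * M)"
        by (rule order_trans[OF Bochner_Integration.integral_norm_bound integral_mono'])
          (use k kv_bound M0 in auto)
      also have "\<dots> = \<kappa> * M" by (simp add: \<kappa>_def)
      finally show ?thesis unfolding D_def
        using norm_triangle_ineq4[of "\<kappa> *\<^sub>R v x" "LINT z|lborel. k z *\<^sub>R v (x - e *\<^sub>R z)"]
          mult_left_mono[OF M \<kappa>, of x] \<kappa> by simp
    qed
    have D_lim: "(\<lambda>n. D (1 / real (Suc n)) x) \<longlonglongrightarrow> 0" for x
    proof -
      have "(\<lambda>n. LINT z|lborel. k z *\<^sub>R v (x - (1 / real (Suc n)) *\<^sub>R z)) \<longlonglongrightarrow> (LINT z|lborel. k z *\<^sub>R v x)"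
      proof (rule integral_dominated_convergence)
        show "integrable lborel (\<lambda>z. k z * M)" using k by simp
        show "AE z in lborel. (\<lambda>n. k z *\<^sub>R v (x - (1 / real (Suc n)) *\<^sub>R z)) \<longlonglongrightarrow> k z *\<^sub>R v x"
        proof (rule AE_I2)
          fix z
          have "(\<lambda>n. x - (1 / real (Suc n)) *\<^sub>R z) \<longlonglongrightarrow> x - 0 *\<^sub>R z"
            by (intro tendsto_intros LIMSEQ_Suc[OF lim_1_over_n])
          then show "(\<lambda>n. k z *\<^sub>R v (x - (1 / real (Suc n)) *\<^sub>R z)) \<longlonglongrightarrow> k z *\<^sub>R v x"
            using v(1) by (intro tendsto_intros) (auto intro: continuous_on_tendsto_compose)
        qed
        show "AE z in lborel. norm (k z *\<^sub>R v (x - (1 / real (Suc n)) *\<^sub>R z)) \<le> k z * M" for n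
          using kv_bound by auto
      qed measurable
      also have "(LINT z|lborel. k z *\<^sub>R v x) = \<kappa> *\<^sub>R v x" unfolding \<kappa>_def using k by simp
      finally have "(\<lambda>n. D (1 / real (Suc n)) x) \<longlonglongrightarrow> norm (\<kappa> *\<^sub>R v x - \<kappa> *\<^sub>R v x)"
        unfolding D_def by (intro tendsto_intros)
      then show ?thesis by simp
    qed
    let ?Y = "\<lambda>n. \<integral>\<^sup>+x. ennreal (D (1 / real (Suc n)) x) * indicator (ball 0 R) x \<partial>lborel"
    have Y: "?Y \<longlonglongrightarrow> (\<integral>\<^sup>+x. 0 * indicator (ball (0::'a) R) x \<partial>lborel)"
    proof (rule nn_integral_dominated_convergence)
      show "(\<integral>\<^sup>+x. ennreal (2 * \<kappa> * M) * indicator (ball (0::'a) R) x \<partial>lborel) < \<infinity>"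
        using emeasure_bounded_finite[OF bounded_ball[of "0::'a" R]]
        by (subst nn_integral_cmult_indicator) (simp_all add: ennreal_mult_less_top)
      show "AE x in lborel. ennreal (D (1 / real (Suc n)) x) * indicator (ball 0 R) x \<le>
          ennreal (2 * \<kappa> * M) * indicator (ball 0 R) x" for n
        using D_bound by (auto intro!: mult_right_mono ennreal_leI)
      show "AE x in lborel. (\<lambda>n. ennreal (D (1 / real (Suc n)) x) * indicator (ball 0 R) x) \<longlonglongrightarrow>
          0 * indicator (ball 0 R) x"
      proof (rule AE_I2)
        fix x :: 'a
        have "(\<lambda>n. ennreal (D (1 / real (Suc n)) x)) \<longlonglongrightarrow> 0"
          using tendsto_ennrealI[OF D_lim] by simp
        then show "(\<lambda>n. ennreal (D (1 / real (Suc n)) x) * indicator (ball 0 R) x) \<longlonglongrightarrow>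
            0 * indicator (ball 0 R) x"
          by (auto split: split_indicator)
      qed
    qed measurable
    have step: "?X R \<le> (ennreal (\<kappa> * d) + ennreal (\<kappa> * d)) + ?Y n" for n
    proof -
      define e where "e = 1 / real (Suc n)"
      have e: "e > 0" by (simp add: e_def)
      let ?W = "\<lambda>x. \<integral>\<^sup>+z. ennreal (k z * norm (u (x - e *\<^sub>R z) - v (x - e *\<^sub>R z))) \<partial>lborel"
      have "?X R \<le> (\<integral>\<^sup>+x. (ennreal (\<kappa> * norm (u x - v x)) + ?W x) + ennreal (D e x) * indicator (ball 0 R) x \<partial>lborel)"
      proof (rule nn_integral_mono)
        fix x :: 'a
        have "ennreal (\<kappa> * norm (u x)) \<le> ennreal (norm (LINT z|lborel. k z *\<^sub>R u (x - e *\<^sub>R z))) +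
            (ennreal (\<kappa> * norm (u x - v x)) + (ennreal (D e x) + ?W x))"
          unfolding D_def \<kappa>_def using k v by (intro approximate_identity_le) auto
        also have "\<dots> \<le> I x + (ennreal (\<kappa> * norm (u x - v x)) + (ennreal (D e x) + ?W x))"
          by (intro add_right_mono le e)
        \<comment> \<open>Subtraction in \<open>ennreal\<close> has a side condition for top minus
          top, which is void because the minuend is finite.\<close>
        finally have "ennreal (\<kappa> * norm (u x)) - I x \<le> ennreal (\<kappa> * norm (u x - v x)) + (ennreal (D e x) + ?W x)"
          by (intro ennreal_minus_le_iff[THEN iffD2] conjI) auto
        then show "(ennreal (\<kappa> * norm (u x)) - I x) * indicator (ball 0 R) x \<le>
            (ennreal (\<kappa> * norm (u x - v x)) + ?W x) + ennreal (D e x) * indicator (ball 0 R) x"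
          by (auto split: split_indicator simp: add_ac)
      qed
      also have "\<dots> = ((\<integral>\<^sup>+x. ennreal (\<kappa> * norm (u x - v x)) \<partial>lborel) + (\<integral>\<^sup>+x. ?W x \<partial>lborel)) + ?Y n"
        unfolding e_def by (simp add: nn_integral_add)
      also have "(\<integral>\<^sup>+x. ennreal (\<kappa> * norm (u x - v x)) \<partial>lborel) = ennreal (\<kappa> * (LINT x|lborel. norm (u x - v x)))"
        using u v \<kappa> by (subst nn_integral_eq_integral) auto
      also have "(\<integral>\<^sup>+x. ?W x \<partial>lborel) = ennreal (\<kappa> * (LINT x|lborel. norm (u x - v x)))"
        unfolding \<kappa>_def using k u v by (intro nn_integral_convolution_scaled) auto
      also have "ennreal (\<kappa> * (LINT x|lborel. norm (u x - v x))) \<le> ennreal (\<kappa> * d)"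
        using v(4) \<kappa> by (intro ennreal_leI mult_left_mono) auto
      finally show ?thesis by (simp add: add_mono add_right_mono)
    qed
    have "?X R \<le> (ennreal (\<kappa> * d) + ennreal (\<kappa> * d)) + 0"
    proof (rule LIMSEQ_le_const)
      show "(\<lambda>n. (ennreal (\<kappa> * d) + ennreal (\<kappa> * d)) + ?Y n) \<longlonglongrightarrow> (ennreal (\<kappa> * d) + ennreal (\<kappa> * d)) + 0"
        using Y by (intro tendsto_intros) simp
    qed (use step in auto)
    also have "\<dots> \<le> ennreal \<epsilon>"
      using d \<kappa> \<epsilon> by (simp add: ennreal_plus[symmetric] ennreal_leI del: ennreal_plus)
    finally show ?thesis by simp
  qed
  then have "?X R = 0" for R using ennreal_le_epsilon[of 0 "?X R"] by simp
  then have "AE x in lborel. (ennreal (\<kappa> * norm (u x)) - I x) * indicator (ball 0 R) x = 0" for R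
    by (subst nn_integral_0_iff_AE[symmetric]) measurable
  then have "AE x in lborel. \<forall>n. (ennreal (\<kappa> * norm (u x)) - I x) * indicator (ball 0 (real n)) x = 0"
    unfolding AE_all_countable by blast
  then have "AE x in lborel. ennreal (\<kappa> * norm (u x)) \<le> I x"
  proof eventually_elim
    case (elim x)
    obtain n where "norm x < real n" using reals_Archimedean2 by blast
    then have "ennreal (\<kappa> * norm (u x)) - I x = 0" using elim[rule_format, of n] by simp
    then show ?case by (auto simp: diff_eq_0_iff_ennreal)
  qed
  then show ?thesis by (simp add: \<kappa>_def)
qed

subsection \<open>Integrability and scaling of the kernel\<close>

text \<open>Split into shells k <= |z| < k+1. There the integrand is at most a constant times
  (k+1)^(-d-2), the enclosing ball has volume proportional to (k+1)^d, and the sum of (k+1)^(-2)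
  converges.\<close>

lemma integrable_norm_sq_plus_one_powr:
  "integrable lborel (\<lambda>z::'a::euclidean_space. ((norm z)\<^sup>2 + 1) powr (- (DIM('a) / 2) - 1))"
proof -
  define d where "d = real DIM('a)"
  define \<omega> where "\<omega> = unit_ball_vol (real DIM('a))"
  have \<omega>: "\<omega> \<ge> 0" by (simp add: \<omega>_def)
  define f where "f z = ((norm z)\<^sup>2 + 1) powr (- (d / 2) - 1)" for z :: 'a
  have [measurable]: "f \<in> borel_measurable borel" unfolding f_def by measurable
  \<comment> \<open>This is the power -d/2 - 1 of (k+1)^2 / 2, which is a lower bound of k^2 +
    1.\<close>
  define c where "c k = 2 powr (d / 2 + 1) * (real k + 1) powr (- d - 2)" for k :: nat
  have shell: "f z \<le> c k" if "real k \<le> norm z" for z k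
  proof -
    have "(real k + 1)\<^sup>2 / 2 \<le> (real k)\<^sup>2 + 1"
      using sum_squares_bound[of "real k" 1] by (simp add: power2_eq_square algebra_simps)
    also have "\<dots> \<le> (norm z)\<^sup>2 + 1" using that by (intro add_right_mono power_mono) auto
    finally have "f z \<le> ((real k + 1)\<^sup>2 / 2) powr (- (d / 2) - 1)"
      unfolding f_def d_def by (intro powr_mono2') auto
    also have "\<dots> = c k"
    proof -
      have "(real k + 1)\<^sup>2 = (real k + 1) powr 2" by (simp add: powr_numeral)
      then have "((real k + 1)\<^sup>2) powr (- (d / 2) - 1) = (real k + 1) powr (- d - 2)"
        by (simp only: powr_powr) (simp add: algebra_simps)
      moreover have "2 powr (- (d / 2) - 1) = 1 / 2 powr (d / 2 + 1)"
        using powr_minus_divide[of 2 "d / 2 + 1"] by simp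
      ultimately show ?thesis by (simp add: c_def powr_divide)
    qed
    finally show ?thesis .
  qed
  have shell_mass: "ennreal (c k) * emeasure lborel (ball (0::'a) (real k + 1)) =
      ennreal (2 powr (d / 2 + 1) * \<omega> * (1 / (real (Suc k))\<^sup>2))" for k
  proof -
    have "(real k + 1) powr (- d - 2) * (real k + 1) ^ DIM('a) = (real k + 1) powr (- 2)"
      by (simp add: powr_add[symmetric] powr_realpow[symmetric] d_def)
    also have "\<dots> = 1 / (real (Suc k))\<^sup>2"
      by (simp add: powr_minus powr_numeral inverse_eq_divide add.commute)
    finally have eq: "(real k + 1) powr (- d - 2) * (real k + 1) ^ DIM('a) = 1 / (real (Suc k))\<^sup>2" .
    have "ennreal (c k) * emeasure lborel (ball (0::'a) (real k + 1)) =
        ennreal (2 powr (d / 2 + 1) * \<omega> * ((real k + 1) powr (- d - 2) * (real k + 1) ^ DIM('a)))"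
      using \<omega> by (simp add: emeasure_ball c_def \<omega>_def ennreal_mult[symmetric] mult_ac)
    then show ?thesis by (simp only: eq)
  qed
  have le_suminf: "g k \<le> (\<Sum>k. g k)" for g :: "nat \<Rightarrow> ennreal" and k
    using sum_le_suminf[of g "{k}"] by simp
  have "(\<integral>\<^sup>+z. ennreal (f z) \<partial>lborel) \<le>
      (\<integral>\<^sup>+z. (\<Sum>k. ennreal (c k) * indicator (ball (0::'a) (real k + 1)) z) \<partial>lborel)"
  proof (rule nn_integral_mono)
    fix z :: 'a
    define k where "k = nat \<lfloor>norm z\<rfloor>"
    have "real k \<le> norm z" "norm z < real k + 1" by (auto simp: k_def)
    then have "ennreal (f z) \<le> ennreal (c k) * indicator (ball 0 (real k + 1)) z"
      using shell by (auto intro: ennreal_leI)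
    also have "\<dots> \<le> (\<Sum>k. ennreal (c k) * indicator (ball 0 (real k + 1)) z)"
      by (rule le_suminf)
    finally show "ennreal (f z) \<le> (\<Sum>k. ennreal (c k) * indicator (ball 0 (real k + 1)) z)" .
  qed
  also have "\<dots> = (\<Sum>k. ennreal (c k) * emeasure lborel (ball (0::'a) (real k + 1)))"
  proof -
    have [measurable]: "ball (0::'a) (real k + 1) \<in> sets borel" for k by simp
    show ?thesis by (subst nn_integral_suminf) (simp_all add: nn_integral_cmult_indicator)
  qed
  also have "\<dots> < top"
  proof -
    have "summable (\<lambda>k. 1 / (real (Suc k))\<^sup>2)"
      using inverse_power_summable[of 2] by (subst summable_Suc_iff) (simp add: inverse_eq_divide)
    then have "summable (\<lambda>k. 2 powr (d / 2 + 1) * \<omega> * (1 / (real (Suc k))\<^sup>2))"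
      by (rule summable_mult)
    then show ?thesis unfolding shell_mass using \<omega> by (subst less_top[symmetric], intro ennreal_suminf_neq_top) auto
  qed
  finally have "(\<integral>\<^sup>+z. ennreal (f z) \<partial>lborel) < top" .
  then have "integrable lborel f" by (intro integrableI_nonneg) (auto simp: f_def)
  then show ?thesis by (simp add: f_def[abs_def] d_def)
qed

lemma integrable_newton_kernel: "integrable lborel (newton_kernel 1 :: real^'n \<Rightarrow> real)"
  unfolding newton_kernel_def[abs_def]
  using integrable_norm_sq_plus_one_powr[where 'a="real^'n"] by simp

text \<open>Dimension at least 3 makes the factor n - 2 positive; in dimension 2 the kernel, and
  with it the constant of the theorem, would be 0.\<close>

lemma newton_kernel_pos:
  assumes "CARD('n) \<ge> 3" "e > 0"
  shows "newton_kernel e (z :: real^'n) > 0"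
proof -
  have "(norm z)\<^sup>2 + e\<^sup>2 > 0" using assms(2) by (simp add: add_nonneg_pos)
  with assms show ?thesis by (simp add: newton_kernel_def)
qed

lemma integral_newton_kernel_pos:
  assumes "CARD('n) \<ge> 3"
  shows "(LINT z|lborel. newton_kernel 1 (z :: real^'n)) > 0"
proof -
  have pos: "newton_kernel 1 (z :: real^'n) > 0" for z
    using newton_kernel_pos[OF assms, of 1 z] by simp
  have "(LINT z|lborel. newton_kernel 1 (z :: real^'n)) \<noteq> 0"
  proof
    assume "(LINT z|lborel. newton_kernel 1 (z :: real^'n)) = 0"
    then have "AE z in lborel. newton_kernel 1 (z :: real^'n) = 0"
      using integral_nonneg_eq_0_iff_AE[OF integrable_newton_kernel[where 'n='n]] pos
      by (auto intro: less_imp_le)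
    then have "AE z :: real^'n in lborel. False" using pos by (auto elim!: AE_mp simp: less_le)
    then show False by (simp add: eventually_False ae_filter_eq_bot_iff)
  qed
  moreover have "(LINT z|lborel. newton_kernel 1 (z :: real^'n)) \<ge> 0"
    using pos by (intro Bochner_Integration.integral_nonneg) (auto intro: less_imp_le)
  ultimately show ?thesis by simp
qed

text \<open>The bracket is homogeneous and yields e^(-n-2), which cancels the e^2 of the kernel and
  the Jacobian e^n.\<close>

lemma newton_kernel_scale:
  fixes z :: "real^'n"
  assumes "e > 0"
  shows "e ^ CARD('n) * newton_kernel e (e *\<^sub>R z) = newton_kernel 1 z"
proof -
  define n where "n = real CARD('n)"
  have "(norm (e *\<^sub>R z))\<^sup>2 + e\<^sup>2 = e powr 2 * ((norm z)\<^sup>2 + 1)"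
    using assms by (simp add: power_mult_distrib algebra_simps powr_numeral)
  then have "((norm (e *\<^sub>R z))\<^sup>2 + e\<^sup>2) powr (- (n / 2) - 1) =
      (e powr 2) powr (- (n / 2) - 1) * ((norm z)\<^sup>2 + 1) powr (- (n / 2) - 1)"
    by (simp only: powr_mult)
  also have "(e powr 2) powr (- (n / 2) - 1) = e powr (- n - 2)"
    by (simp only: powr_powr) (simp add: algebra_simps)
  finally have eq: "((norm (e *\<^sub>R z))\<^sup>2 + e\<^sup>2) powr (- (n / 2) - 1) =
      e powr (- n - 2) * ((norm z)\<^sup>2 + 1) powr (- (n / 2) - 1)" .
  have "e ^ CARD('n) * e\<^sup>2 * e powr (- n - 2) = e powr n * e powr 2 * e powr (- n - 2)"
    using assms by (simp add: n_def powr_realpow powr_numeral)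
  also have "\<dots> = 1" using assms by (simp only: powr_add[symmetric]) simp
  finally have one: "e ^ CARD('n) * e\<^sup>2 * e powr (- n - 2) = 1" .
  have "e ^ CARD('n) * newton_kernel e (e *\<^sub>R z) =
      n * (n - 2) * (e ^ CARD('n) * e\<^sup>2 * e powr (- n - 2)) * ((norm z)\<^sup>2 + 1) powr (- (n / 2) - 1)"
    unfolding newton_kernel_def n_def[symmetric] eq by (simp only: mult_ac)
  then show ?thesis unfolding one by (simp add: newton_kernel_def n_def)
qed

lemma lborel_integral_affine:
  fixes f :: "'a::euclidean_space \<Rightarrow> 'b::{banach, second_countable_topology}"
  assumes [measurable]: "f \<in> borel_measurable borel" and c: "c \<noteq> 0"
  shows "(LINT y|lborel. f y) = \<bar>c\<bar> ^ DIM('a) *\<^sub>R (LINT z|lborel. f (t + c *\<^sub>R z))"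
proof -
  have "(LINT y|lborel. f y) =
      (LINT y|density (distr lborel borel (\<lambda>x. t + c *\<^sub>R x)) (\<lambda>_. ennreal (\<bar>c\<bar> ^ DIM('a))). f y)"
    using lborel_affine[OF c, of t] by (simp add: ennreal_power)
  also have "\<dots> = \<bar>c\<bar> ^ DIM('a) *\<^sub>R (LINT z|lborel. f (t + c *\<^sub>R z))"
    by (subst integral_density) (simp_all add: integral_distr)
  finally show ?thesis .
qed

text \<open>Substitute y = x - e z; the left side is the form for the approximate identity, the
  right side the one that testing produces.\<close>

lemma newton_kernel_convolution:
  fixes u :: "real^'n \<Rightarrow> complex"
  assumes [measurable]: "u \<in> borel_measurable borel" and e: "e > 0"
  shows "(LINT z|lborel. newton_kernel 1 z *\<^sub>R u (x - e *\<^sub>R z)) =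
    (LINT y|lborel. newton_kernel e (x - y) *\<^sub>R u y)"
proof -
  have [measurable]: "newton_kernel e \<in> borel_measurable (borel :: (real^'n) measure)"
    unfolding newton_kernel_def[abs_def] by measurable
  have "(LINT y|lborel. newton_kernel e (x - y) *\<^sub>R u y) = \<bar>- e\<bar> ^ DIM(real^'n) *\<^sub>R
      (LINT z|lborel. newton_kernel e (x - (x + (- e) *\<^sub>R z)) *\<^sub>R u (x + (- e) *\<^sub>R z))"
    using e by (intro lborel_integral_affine) auto
  also have "\<dots> = (LINT z|lborel. (e ^ CARD('n) * newton_kernel e (e *\<^sub>R z)) *\<^sub>R u (x - e *\<^sub>R z))"
    using e by (simp flip: integral_scaleR_right)
  finally show ?thesis unfolding newton_kernel_scale[OF e] ..
qed

subsection \<open>The potential bound and the lower bound for eta\<close>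

text \<open>The complement of the support is a union of possibly uncountably many open sets on which
  u vanishes almost everywhere. Lindelof reduces it to a countable union, so the exceptional sets
  together remain null.\<close>

lemma ess_support_subset_ball:
  assumes "ess_support u \<subseteq> ball a r"
  shows "AE x in lebesgue. x \<notin> ball a r \<longrightarrow> u x = 0"
proof -
  let ?F = "{U. open U \<and> (AE x in lebesgue. x \<in> U \<longrightarrow> u x = 0)}"
  obtain F where F: "F \<subseteq> ?F" "countable F" "\<Union>F = \<Union>?F"
    using Lindelof[of ?F] by auto
  have "AE x in lebesgue. \<forall>U\<in>F. x \<in> U \<longrightarrow> u x = 0"
    using F by (subst AE_ball_countable) auto
  then show ?thesis
  proof eventually_elim
    case (elim x)
    have "x \<in> \<Union>F" if "x \<notin> ball a r"
      using that assms F(3) unfolding ess_support_def by blast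
    with elim show ?case by blast
  qed
qed

lemma completion_ex_borel_measurable_complex:
  fixes g :: "'a \<Rightarrow> complex"
  assumes g: "g \<in> borel_measurable (completion M)"
  obtains g' where "g' \<in> borel_measurable M" "AE x in M. g x = g' x"
proof -
  obtain a b where ab: "a \<in> borel_measurable M" "AE x in M. Re (g x) = a x"
    "b \<in> borel_measurable M" "AE x in M. Im (g x) = b x"
    using completion_ex_borel_measurable_real[of "\<lambda>x. Re (g x)" M]
      completion_ex_borel_measurable_real[of "\<lambda>x. Im (g x)" M] g by auto
  show ?thesis
  proof
    show "(\<lambda>x. Complex (a x) (b x)) \<in> borel_measurable M"
      using ab unfolding Complex_eq by measurable
    show "AE x in M. g x = Complex (a x) (b x)"
      using ab(2,4) by eventually_elim (simp add: complex_eq_iff)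
  qed
qed

section \<open>The weak Laplacian: local integrability and the tested equation\<close>

lemma locally_integrable_sum:
  assumes "\<And>i. i \<in> A \<Longrightarrow> locally_integrable (f i)"
  shows "locally_integrable (\<lambda>x. \<Sum>i\<in>A. f i x)"
  using assms unfolding locally_integrable_def set_integrable_def
  by (auto simp: scaleR_sum_right intro!: Bochner_Integration.integrable_sum)

lemma laplacian_locally_integrable:
  assumes "\<And>i. has_weak_deriv [i, i] u (weak_deriv [i, i] u)"
  shows "locally_integrable (laplacian u)"
  using assms unfolding laplacian_def[abs_def] has_weak_deriv_def
  by (intro locally_integrable_sum) blast

text \<open>The order is two, so the sign of integration by parts is +1. To sum over the directions
  each integral must exist, which holds because all derivatives of a test function vanish off its
  support.\<close>

lemma laplacian_weak:
  fixes u :: "real^'n \<Rightarrow> complex"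
  assumes u: "\<And>i. has_weak_deriv [i, i] u (weak_deriv [i, i] u)" and \<phi>: "\<phi> \<in> test_functions"
  shows "(LINT x|lebesgue. (\<Sum>i\<in>UNIV. iter_partial_deriv [i, i] \<phi> x) *\<^sub>R u x) =
    (LINT x|lebesgue. \<phi> x *\<^sub>R laplacian u x)"
proof -
  let ?K = "closure {x. \<phi> x \<noteq> 0}"
  have K: "compact ?K" and C: "C_k k \<phi>" for k using \<phi> by (auto simp: test_functions_def)
  have off: "iter_partial_deriv is \<phi> x = 0" if "x \<notin> ?K" for x "is"
  proof -
    have "iter_partial_deriv is \<phi> x = iter_partial_deriv is (\<lambda>_. 0) x"
      using that closure_subset[of "{x. \<phi> x \<noteq> 0}"]
      by (intro iter_partial_deriv_cong_open[of "- ?K"]) auto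
    also have "iter_partial_deriv is (\<lambda>_. 0) = (\<lambda>_. 0)"
      by (induction "is") (auto simp: partial_deriv_const)
    finally show ?thesis .
  qed
  have int: "integrable lebesgue (\<lambda>x. iter_partial_deriv is \<phi> x *\<^sub>R f x)"
    if "locally_integrable f" for f :: "real^'n \<Rightarrow> complex" and "is"
    using C_k_continuous[OF C_k_iter_partial_deriv[OF C]] off
    by (intro integrable_continuous_scaleR_locally_integrable[OF that _ K]) auto
  have loc: "locally_integrable u" "locally_integrable (weak_deriv [i, i] u)" for i
    using u by (auto simp: has_weak_deriv_def)
  have weak: "(LINT x|lebesgue. iter_partial_deriv [i, i] \<phi> x *\<^sub>R u x) =
      (LINT x|lebesgue. \<phi> x *\<^sub>R weak_deriv [i, i] u x)" for i
    using u[of i] \<phi> by (simp add: has_weak_deriv_def del: iter_partial_deriv.simps)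
  show ?thesis
    \<comment> \<open>The empty list of directions stands for \<open>\<phi>\<close> itself.\<close>
    using int[OF loc(1)] int[OF loc(2), of "[]"] weak
    by (simp add: laplacian_def scaleR_sum_left scaleR_sum_right Bochner_Integration.integral_sum
        del: iter_partial_deriv.simps(2))
qed

text \<open>\<open>approximate_identity_bound\<close> is applied with k =
  \<open>newton_kernel 1\<close> and the potential as \<open>I\<close>. As it works on
  \<open>lborel\<close>, u is replaced by a Borel representative; \<open>h\<close> plays this part
  for the norm of \<open>L\<close> and makes the potential Borel measurable.\<close>

lemma riesz_potential_bound:
  fixes u L :: "real^'n \<Rightarrow> complex" and h :: "real^'n \<Rightarrow> ennreal"
  assumes n: "CARD('n) \<ge> 3" and r: "r > 0"
    and u: "locally_integrable u" and u0: "AE x in lebesgue. x \<notin> ball a r \<longrightarrow> u x = 0"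
    and L: "locally_integrable L" and L0: "AE x in lebesgue. x \<notin> ball a r \<longrightarrow> L x = 0"
    and weak: "\<And>\<phi>. \<phi> \<in> test_functions \<Longrightarrow>
      (LINT x|lebesgue. (\<Sum>i\<in>UNIV. iter_partial_deriv [i, i] \<phi> x) *\<^sub>R u x) = (LINT x|lebesgue. \<phi> x *\<^sub>R L x)"
    and h[measurable]: "h \<in> borel_measurable borel" and hL: "AE x in lborel. ennreal (norm (L x)) = h x"
  shows "AE x in lborel. ennreal ((LINT z|lborel. newton_kernel 1 (z::real^'n)) * norm (u x)) \<le>
    (\<integral>\<^sup>+y. h y * ennreal (1 / norm (x - y) ^ (CARD('n) - 2)) \<partial>lborel)"
proof -
  let ?I = "\<lambda>x. \<integral>\<^sup>+y. h y * ennreal (1 / norm (x - y) ^ (CARD('n) - 2)) \<partial>lborel"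
  obtain v where v[measurable]: "v \<in> borel_measurable borel" and uv: "AE x in lborel. u x = v x"
    using completion_ex_borel_measurable_complex[OF locally_integrable_measurable[OF u]] by auto
  have uv': "AE x in lebesgue. u x = v x" using uv by (rule AE_completion)
  have [measurable]: "u \<in> borel_measurable lebesgue" by (rule locally_integrable_measurable[OF u])
  have [measurable]: "v \<in> borel_measurable lebesgue" by (rule measurable_completion) (use v in simp)
  have "integrable lebesgue v"
    using locally_integrable_integrable[OF u u0] uv' by (subst integrable_cong_AE[of v _ u]) auto
  then have int: "integrable lborel v" by (simp add: integrable_completion)
  have bound: "ennreal (norm (LINT z|lborel. newton_kernel 1 z *\<^sub>R v (x - e *\<^sub>R z))) \<le> ?I x"
    if e: "e > 0" for e x
  proof -
    have "continuous_on UNIV (\<lambda>y. newton_kernel e (x - y))"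
      unfolding newton_kernel_def using e
      by (intro continuous_intros) (auto simp: add_nonneg_eq_0_iff)
    then have k[measurable]: "(\<lambda>y. newton_kernel e (x - y)) \<in> borel_measurable borel"
      by (rule borel_measurable_continuous_onI)
    have [measurable]: "(\<lambda>y. newton_kernel e (x - y)) \<in> borel_measurable lebesgue"
      by (rule measurable_completion) (use k in simp)
    have "(LINT z|lborel. newton_kernel 1 z *\<^sub>R v (x - e *\<^sub>R z)) =
        (LINT y|lborel. newton_kernel e (x - y) *\<^sub>R v y)"
      by (rule newton_kernel_convolution[OF v e])
    also have "\<dots> = (LINT y|lebesgue. newton_kernel e (x - y) *\<^sub>R v y)"
      by (rule integral_completion[symmetric]) measurable
    also have "\<dots> = (LINT y|lebesgue. newton_kernel e (x - y) *\<^sub>R u y)"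
      using uv' by (intro integral_cong_AE) auto
    finally have "ennreal (norm (LINT z|lborel. newton_kernel 1 z *\<^sub>R v (x - e *\<^sub>R z))) \<le>
        (\<integral>\<^sup>+y. ennreal (norm (L y) / norm (x - y) ^ (CARD('n) - 2)) \<partial>lebesgue)"
      using norm_newton_kernel_integral_le[OF _ e r u u0 L L0 weak, of x] n by simp
    also have "\<dots> = (\<integral>\<^sup>+y. ennreal (norm (L y) / norm (x - y) ^ (CARD('n) - 2)) \<partial>lborel)"
      by (rule nn_integral_completion)
    also have "\<dots> = ?I x"
    proof (rule nn_integral_cong_AE)
      show "AE y in lborel. ennreal (norm (L y) / norm (x - y) ^ (CARD('n) - 2)) =
          h y * ennreal (1 / norm (x - y) ^ (CARD('n) - 2))"
        using hL
      proof eventually_elim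
        case (elim y)
        show ?case unfolding elim[symmetric] by (subst ennreal_mult[symmetric]) simp_all
      qed
    qed
    finally show ?thesis .
  qed
  have "AE x in lborel. ennreal ((LINT z|lborel. newton_kernel 1 (z::real^'n)) * norm (v x)) \<le> ?I x"
    using newton_kernel_pos[OF n zero_less_one]
    by (intro approximate_identity_bound[OF int integrable_newton_kernel _ _ bound])
      (auto intro: less_imp_le)
  with uv show ?thesis by eventually_elim simp
qed

section \<open>Absorption: from the potential bound to the lower bound for eta\<close>

lemma kato_eta_ge_integral_newton_kernel:
  fixes u V :: "real^'n \<Rightarrow> complex"
  assumes n: "CARD('n) \<ge> 3" and r: "r > 0"
    and V: "V \<in> borel_measurable lebesgue"
    and u: "\<And>i. has_weak_deriv [i, i] u (weak_deriv [i, i] u)"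
    and nonzero: "\<not> (AE x in lebesgue. u x = 0)"
    and ineq: "AE x in lebesgue. norm (laplacian u x) \<le> norm (V x * u x)"
    and supp: "ess_support u \<subseteq> ball a r"
  shows "ennreal (LINT z|lborel. newton_kernel 1 (z::real^'n)) \<le> kato_eta (2 * r) V"
proof -
  define \<kappa> where "\<kappa> = (LINT z|lborel. newton_kernel 1 (z::real^'n))"
  have \<kappa>: "\<kappa> > 0" unfolding \<kappa>_def by (rule integral_newton_kernel_pos[OF n])
  have u0: "AE x in lebesgue. x \<notin> ball a r \<longrightarrow> u x = 0" by (rule ess_support_subset_ball[OF supp])
  have L0: "AE x in lebesgue. x \<notin> ball a r \<longrightarrow> laplacian u x = 0"
    \<comment> \<open>The differential inequality itself forces the Laplacian to vanish almost
      everywhere that u does.\<close>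
    using u0 ineq by eventually_elim auto
  have u_loc: "locally_integrable u" using u by (auto simp: has_weak_deriv_def)
  have L_loc: "locally_integrable (laplacian u)" by (rule laplacian_locally_integrable[OF u])
  have [measurable]: "laplacian u \<in> borel_measurable lebesgue"
    by (rule locally_integrable_measurable[OF L_loc])
  \<comment> \<open>Borel representatives \<open>h\<close> of |Delta u| and \<open>w\<close> of |V|
    are chosen because the exchange of integrals below takes place on \<open>lborel\<close>.\<close>
  have "(\<lambda>x. ennreal (norm (laplacian u x))) \<in> borel_measurable lebesgue" by measurable
  from completion_ex_borel_measurable[OF this] obtain h where "h \<in> borel_measurable lborel"
    and hL: "AE x in lborel. ennreal (norm (laplacian u x)) = h x" by blast
  then have h[measurable]: "h \<in> borel_measurable borel" by simp
  have "(\<lambda>x. ennreal (norm (V x))) \<in> borel_measurable lebesgue" using V by measurable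
  from completion_ex_borel_measurable[OF this] obtain w where "w \<in> borel_measurable lborel"
    and wV: "AE x in lborel. ennreal (norm (V x)) = w x" by blast
  then have w[measurable]: "w \<in> borel_measurable borel" by simp
  let ?G = "\<lambda>x y::real^'n. ennreal (1 / norm (x - y) ^ (CARD('n) - 2))"
  let ?I = "\<lambda>x. \<integral>\<^sup>+y. h y * ?G x y \<partial>lborel"
  have [measurable]: "ball a r \<in> sets borel" "ball y (2 * r) \<in> sets borel" for y :: "real^'n" by auto
  have pot: "AE x in lborel. ennreal (\<kappa> * norm (u x)) \<le> ?I x"
    unfolding \<kappa>_def by (rule riesz_potential_bound[OF n r u_loc u0 L_loc L0 laplacian_weak[OF u] h hL])
  define H where "H = (\<integral>\<^sup>+x. h x \<partial>lborel)"
  have "H = (\<integral>\<^sup>+x. ennreal (norm (laplacian u x)) \<partial>lborel)"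
    unfolding H_def using hL by (intro nn_integral_cong_AE) auto
  also have "\<dots> = (\<integral>\<^sup>+x. ennreal (norm (laplacian u x)) \<partial>lebesgue)"
    by (rule nn_integral_completion[symmetric])
  also have "\<dots> < top"
    using locally_integrable_integrable[OF L_loc L0] by (simp add: integrable_iff_bounded)
  finally have H_fin: "H \<noteq> top" by simp
  have H_nz: "H \<noteq> 0"
  proof
    assume "H = 0"
    then have "AE y in lborel. h y = 0" by (simp add: H_def nn_integral_0_iff_AE)
    then have "?I x = (\<integral>\<^sup>+(y::real^'n). 0 \<partial>lborel)" for x
      by (intro nn_integral_cong_AE) auto
    with pot have "AE x in lborel. u x = 0" using \<kappa> by (auto simp: mult_le_0_iff)
    with nonzero show False using AE_completion by blast
  qed
  \<comment> \<open>By symmetry of the kernel, the x-integral left after the exchange is bounded by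
    the integral in \<open>kato_eta\<close> centred at y. At x = y both integrands are governed by
    the same division convention.\<close>
  have kernel: "(\<integral>\<^sup>+x. (indicator (ball a r) x * w x) * ?G x y \<partial>lborel) \<le> kato_eta (2 * r) V"
    if y: "y \<in> ball a r" for y
  proof -
    have "(\<integral>\<^sup>+x. (indicator (ball a r) x * w x) * ?G x y \<partial>lborel) \<le>
        (\<integral>\<^sup>+x\<in>ball y (2 * r). ennreal (norm (V x) / norm (y - x) ^ (CARD('n) - 2)) \<partial>lborel)"
    proof (rule nn_integral_mono_AE)
      show "AE x in lborel. (indicator (ball a r) x * w x) * ?G x y \<le>
          ennreal (norm (V x) / norm (y - x) ^ (CARD('n) - 2)) * indicator (ball y (2 * r)) x"
        using wV
      proof eventually_elim
        case (elim x)
        have "x \<in> ball y (2 * r)" if "x \<in> ball a r"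
          using that y dist_triangle_less_add[of y a r x r] by (simp add: dist_commute)
        moreover have "w x * ?G x y = ennreal (norm (V x) / norm (y - x) ^ (CARD('n) - 2))"
          unfolding elim[symmetric] norm_minus_commute[of y x] by (subst ennreal_mult[symmetric]) simp_all
        ultimately show ?case by (auto split: split_indicator simp del: mem_ball)
      qed
    qed
    also have "\<dots> = (\<integral>\<^sup>+x\<in>ball y (2 * r). ennreal (norm (V x) / norm (y - x) ^ (CARD('n) - 2)) \<partial>lebesgue)"
      by (rule nn_integral_completion[symmetric])
    also have "\<dots> \<le> kato_eta (2 * r) V" unfolding kato_eta_def by (rule SUP_upper) simp
    finally show ?thesis .
  qed
  have "ennreal \<kappa> * H = (\<integral>\<^sup>+x. ennreal \<kappa> * h x \<partial>lborel)"
    by (simp add: H_def nn_integral_cmult)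
  also have "\<dots> \<le> (\<integral>\<^sup>+x. (indicator (ball a r) x * w x) * ?I x \<partial>lborel)"
  proof (rule nn_integral_mono_AE)
    have "AE x in lborel. x \<notin> ball a r \<longrightarrow> laplacian u x = 0"
      "AE x in lborel. norm (laplacian u x) \<le> norm (V x * u x)"
      using L0 ineq by (simp_all only: AE_completion_iff)
    with hL wV pot show "AE x in lborel. ennreal \<kappa> * h x \<le> (indicator (ball a r) x * w x) * ?I x"
    proof eventually_elim
      case (elim x)
      show ?case
      proof (cases "x \<in> ball a r")
        case True
        have "ennreal \<kappa> * h x \<le> ennreal \<kappa> * ennreal (norm (V x) * norm (u x))"
          unfolding elim(1)[symmetric] using elim(5) by (intro mult_left_mono ennreal_leI) (auto simp: norm_mult)
        also have "\<dots> = w x * ennreal (\<kappa> * norm (u x))"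
          unfolding elim(2)[symmetric] using \<kappa> by (simp add: mult_ac flip: ennreal_mult)
        also have "\<dots> \<le> w x * ?I x" using elim(3) by (intro mult_left_mono) auto
        finally show ?thesis using True by simp
      next
        case False
        then show ?thesis using elim(1,4) by simp
      qed
    qed
  qed
  also have "\<dots> = (\<integral>\<^sup>+x. \<integral>\<^sup>+y. (indicator (ball a r) x * w x) * (h y * ?G x y) \<partial>lborel \<partial>lborel)"
    by (simp add: nn_integral_cmult)
  also have "\<dots> = (\<integral>\<^sup>+y. \<integral>\<^sup>+x. (indicator (ball a r) x * w x) * (h y * ?G x y) \<partial>lborel \<partial>lborel)"
    by (rule lborel_pair.Fubini'[symmetric]) measurable
  also have "\<dots> = (\<integral>\<^sup>+y. h y * (\<integral>\<^sup>+x. (indicator (ball a r) x * w x) * ?G x y \<partial>lborel) \<partial>lborel)"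
    by (subst nn_integral_cmult[symmetric]) (simp_all add: mult_ac)
  also have "\<dots> \<le> (\<integral>\<^sup>+y. h y * kato_eta (2 * r) V \<partial>lborel)"
  proof (rule nn_integral_mono_AE)
    have "AE x in lborel. x \<notin> ball a r \<longrightarrow> laplacian u x = 0"
      using L0 by (simp only: AE_completion_iff)
    with hL show "AE y in lborel. h y * (\<integral>\<^sup>+x. (indicator (ball a r) x * w x) * ?G x y \<partial>lborel) \<le>
        h y * kato_eta (2 * r) V"
    proof eventually_elim
      case (elim y)
      show ?case
      proof (cases "y \<in> ball a r")
        case True
        then show ?thesis by (intro mult_left_mono kernel) auto
      next
        case False
        then have "h y = 0" using elim by simp
        then show ?thesis by simp
      qed
    qed
  qed
  also have "\<dots> = H * kato_eta (2 * r) V" by (simp add: H_def nn_integral_multc)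
  finally have "H * ennreal \<kappa> \<le> H * kato_eta (2 * r) V" by (simp add: mult.commute)
  then show ?thesis
    unfolding \<kappa>_def[symmetric] by (simp add: ennreal_mult_le_mult_iff H_nz H_fin)
qed

text \<open>The constants are quantified before V, u, a and r, so they depend on the dimension only.
  Nontriviality of u is demanded explicitly, since u = 0 and V = 0 satisfy everything else while eta
  is 0.\<close>

theorem theorem1p3:
  assumes "CARD('n::finite) \<ge> 3"
  shows "\<exists>C::real. C > 0 \<and> (\<exists>r\<^sub>0::real. r\<^sub>0 > 0 \<and>
    (\<forall>(V :: real ^ 'n \<Rightarrow> complex) (u :: real ^ 'n \<Rightarrow> complex) (a :: real ^ 'n) (r :: real).
       0 < r \<and> r < r\<^sub>0 \<and>
       V \<in> borel_measurable lebesgue \<and>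
       u \<in> sobolev 2 2 \<and>
       \<not> (AE x in lebesgue. u x = 0) \<and>
       (AE x in lebesgue. norm (laplacian u x) \<le> norm (V x * u x)) \<and>
       ess_support u \<subseteq> ball a r \<and>
       (\<lambda>x. indicator (ball a r) x * V x) \<in> kato_class
       \<longrightarrow> kato_eta (2 * r) V \<ge> ennreal C))"
proof (rule exI[of _ "LINT z|lborel. newton_kernel 1 (z::real^'n)"],
    intro conjI integral_newton_kernel_pos assms, rule exI[of _ 1], intro conjI zero_less_one allI impI)
  \<comment> \<open>The witness for C is the mass of the kernel; any positive number could serve as
    \<open>r\<^sub>0\<close>, and 1 is taken.\<close>
  fix V u :: "real^'n \<Rightarrow> complex" and a :: "real^'n" and r :: real
  assume *: "0 < r \<and> r < 1 \<and>
       V \<in> borel_measurable lebesgue \<and>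
       u \<in> sobolev 2 2 \<and>
       \<not> (AE x in lebesgue. u x = 0) \<and>
       (AE x in lebesgue. norm (laplacian u x) \<le> norm (V x * u x)) \<and>
       ess_support u \<subseteq> ball a r \<and>
       (\<lambda>x. indicator (ball a r) x * V x) \<in> kato_class"
  \<comment> \<open>\<open>weak_deriv\<close> is a choice; existence for the lists
    \<open>[i, i]\<close>, which order 2 provides, makes it a genuine weak derivative.\<close>
  have "\<exists>g. has_weak_deriv [i, i] u g" for i
  proof -
    have "length [i, i] \<le> 2" by simp
    then show ?thesis using * unfolding sobolev_def by blast
  qed
  then have "has_weak_deriv [i, i] u (weak_deriv [i, i] u)" for i
    unfolding weak_deriv_def by (rule someI_ex)
  with * show "ennreal (LINT z|lborel. newton_kernel 1 (z::real^'n)) \<le> kato_eta (2 * r) V"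
    by (intro kato_eta_ge_integral_newton_kernel assms) auto
qed

end
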